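(* For $i=1,2$ let $R_i$ be a unital ring whose additive group is finitely generated and torsion-free, let $\mathcal L_i\subseteq R_i$ be a full rank subgroup, and let $M_i\subseteq R_i^\times$ be a submonoid such that $\mathcal L_i$ is invariant under left multiplication by $M_i$. Assume that ${\rm span}_{\mathbb Z}(M_i)$ has finite index in $R_i$, that $M_i$ contains some integer $\kappa_i\in\mathbb Z\setminus\{0,1\}$, and that $\mathbb QR_i$ is a semisimple $\mathbb Q$-algebra. If the topological groupoids $(\mathbb QR_1\rtimes\langle M_1\rangle)\ltimes\overline{\mathcal L_1}$ and $(\mathbb QR_2\rtimes\langle M_2\rangle)\ltimes\overline{\mathcal L_2}$ are isomorphic, then there are $\mathbb Q$-algebra isomorphisms $\varphi_1\colon\mathbb QR_1\to\mathbb QR_2$ and $\varphi_2\colon\mathbb QR_2\to\mathbb QR_1$ with $\varphi_1(\langle M_1\rangle)\subseteq\langle M_2\rangle$ and $\varphi_2(\langle M_2\rangle)\subseteq\langle M_1\rangle$.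
   Context: $\mathbb QR=\mathbb Q\otimes_{\mathbb Z}R$; $R^\times$ is the monoid of left regular elements of $R$ (those $a$ with $x\mapsto ax$ injective); $\langle M\rangle$ is the subgroup of $(\mathbb QR)^*$ generated by $M$; full rank means the rank of $\mathcal L$ equals that of $R$. The constructible subgroups of $M\curvearrowright\mathcal L$ form the smallest family of subgroups of $\mathcal L$ containing $\mathcal L$ and closed under $C\mapsto aC$ and $C\mapsto\{x\in\mathcal L:ax\in C\}$ ($a\in M$); they have finite index and $\overline{\mathcal L}=\varprojlim_C\mathcal L/C$. $\mathbb QR\rtimes\langle M\rangle$ acts on $\mathbb QR$ by $(b,u).x=b+ux$; its restriction to $\mathcal L$ is a partial action extending uniquely to a partial action on $\overline{\mathcal L}$ by homeomorphisms between open sets; the groupoid is its partial transformation groupoid. Semisimple: trivial Jacobson radical. *)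

theory Defs
  imports "HOL-Analysis.Analysis"
begin

definition add_subgroup :: "'a::ring_1 set \<Rightarrow> bool" where
  "add_subgroup G \<longleftrightarrow> 0 \<in> G \<and> (\<forall>x\<in>G. \<forall>y\<in>G. x + y \<in> G \<and> - x \<in> G)"

definition subring1 :: "'a::ring_1 set \<Rightarrow> bool" where
  "subring1 R \<longleftrightarrow> add_subgroup R \<and> 1 \<in> R \<and> (\<forall>x\<in>R. \<forall>y\<in>R. x * y \<in> R)"

definition zspan :: "'a::ring_1 set \<Rightarrow> 'a set" where
  "zspan S = {x. \<exists>F c. finite F \<and> F \<subseteq> S \<and> x = (\<Sum>s\<in>F. of_int (c s) * s)}"

definition zindep :: "'a::ring_1 set \<Rightarrow> bool" where
  "zindep S \<longleftrightarrow> (\<forall>F c. finite F \<longrightarrow> F \<subseteq> S \<longrightarrow>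
      (\<Sum>s\<in>F. of_int (c s) * s) = 0 \<longrightarrow> (\<forall>s\<in>F. c s = (0::int)))"

definition zrank :: "'a::ring_1 set \<Rightarrow> nat" where
  "zrank G = Max {card S | S. finite S \<and> S \<subseteq> G \<and> zindep S}"

definition fg_add :: "'a::ring_1 set \<Rightarrow> bool" where
  "fg_add R \<longleftrightarrow> (\<exists>S. finite S \<and> S \<subseteq> R \<and> R = zspan S)"

text \<open>The ambient ring is a Q-algebra (nonzero integers invertible) equal to Q R.\<close>
definition is_QR :: "'a::ring_1 set \<Rightarrow> bool" where
  "is_QR R \<longleftrightarrow> (\<forall>n::int. n \<noteq> 0 \<longrightarrow> (\<exists>y::'a. of_int n * y = 1 \<and> y * of_int n = 1))
              \<and> (\<forall>x. \<exists>n::int. \<exists>r\<in>R. n \<noteq> 0 \<and> of_int n * x = r)"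

definition left_regular :: "'a::ring_1 set \<Rightarrow> 'a set" where
  "left_regular R = {a\<in>R. \<forall>x\<in>R. \<forall>y\<in>R. a * x = a * y \<longrightarrow> x = y}"

definition submonoid :: "'a::ring_1 set \<Rightarrow> bool" where
  "submonoid M \<longleftrightarrow> 1 \<in> M \<and> (\<forall>x\<in>M. \<forall>y\<in>M. x * y \<in> M)"

definition finite_index :: "'a::ring_1 set \<Rightarrow> 'a set \<Rightarrow> bool" where
  "finite_index H G \<longleftrightarrow> (\<exists>F. finite F \<and> F \<subseteq> G \<and> (\<forall>x\<in>G. \<exists>f\<in>F. x - f \<in> H))"

definition left_ideal :: "'a::ring_1 set \<Rightarrow> bool" where
  "left_ideal I \<longleftrightarrow> add_subgroup I \<and> (\<forall>a x. x \<in> I \<longrightarrow> a * x \<in> I)"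

definition maximal_left_ideal :: "'a::ring_1 set \<Rightarrow> bool" where
  "maximal_left_ideal I \<longleftrightarrow> left_ideal I \<and> I \<noteq> UNIV \<and>
     (\<forall>J. left_ideal J \<longrightarrow> I \<subseteq> J \<longrightarrow> J \<noteq> UNIV \<longrightarrow> J = I)"

definition jacobson_radical :: "'a::ring_1 set" where
  "jacobson_radical = \<Inter> {I. maximal_left_ideal I}"

inductive_set gen_group :: "'a::ring_1 set \<Rightarrow> 'a set" for M where
  one: "1 \<in> gen_group M"
| gen: "m \<in> M \<Longrightarrow> m \<in> gen_group M"
| inv: "m \<in> M \<Longrightarrow> m * v = 1 \<Longrightarrow> v * m = 1 \<Longrightarrow> v \<in> gen_group M"
| mult: "x \<in> gen_group M \<Longrightarrow> y \<in> gen_group M \<Longrightarrow> x * y \<in> gen_group M"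

definition coset :: "'a::ring_1 \<Rightarrow> 'a set \<Rightarrow> 'a set" where
  "coset a C = (\<lambda>c. a + c) ` C"

inductive_set constructible :: "'a::ring_1 set \<Rightarrow> 'a set \<Rightarrow> 'a set set" for M L where
  base: "L \<in> constructible M L"
| img: "C \<in> constructible M L \<Longrightarrow> a \<in> M \<Longrightarrow> (\<lambda>x. a * x) ` C \<in> constructible M L"
| pre: "C \<in> constructible M L \<Longrightarrow> a \<in> M \<Longrightarrow> {x\<in>L. a * x \<in> C} \<in> constructible M L"

text \<open>Profinite completion: compatible families of cosets, indexed by constructible subgroups.\<close>
definition Lbar :: "'a::ring_1 set \<Rightarrow> 'a set \<Rightarrow> ('a set \<Rightarrow> 'a set) set" where
  "Lbar M L = {\<xi>. (\<forall>C. C \<notin> constructible M L \<longrightarrow> \<xi> C = {})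
      \<and> (\<forall>C\<in>constructible M L. \<exists>a\<in>L. \<xi> C = coset a C)
      \<and> (\<forall>C\<in>constructible M L. \<forall>D\<in>constructible M L. C \<subseteq> D \<longrightarrow> \<xi> C \<subseteq> \<xi> D)}"

text \<open>Inverse limit topology (each L/C discrete).\<close>
definition Lbar_top :: "'a::ring_1 set \<Rightarrow> 'a set \<Rightarrow> ('a set \<Rightarrow> 'a set) topology" where
  "Lbar_top M L = topology_generated_by
     {{\<xi>\<in>Lbar M L. \<xi> C = X} | C X. C \<in> constructible M L}"

definition lemb :: "'a::ring_1 set \<Rightarrow> 'a set \<Rightarrow> 'a \<Rightarrow> ('a set \<Rightarrow> 'a set)" where
  "lemb M L a = (\<lambda>C. if C \<in> constructible M L then coset a C else {})"

definition pdom :: "'a::ring_1 set \<Rightarrow> 'a \<times> 'a \<Rightarrow> 'a set" where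
  "pdom L g = {x\<in>L. fst g + snd g * x \<in> L}"

text \<open>Graph of the extension to Lbar: closure of the graph of the restricted partial map.\<close>
definition ext_graph :: "'a::ring_1 set \<Rightarrow> 'a set \<Rightarrow> 'a \<times> 'a
      \<Rightarrow> (('a set \<Rightarrow> 'a set) \<times> ('a set \<Rightarrow> 'a set)) set" where
  "ext_graph M L g = (prod_topology (Lbar_top M L) (Lbar_top M L)) closure_of
     {(lemb M L x, lemb M L (fst g + snd g * x)) | x. x \<in> pdom L g}"

definition gpd_arrows :: "'a::ring_1 set \<Rightarrow> 'a set
      \<Rightarrow> (('a set \<Rightarrow> 'a set) \<times> ('a \<times> 'a) \<times> ('a set \<Rightarrow> 'a set)) set" where
  "gpd_arrows M L = {(y, g, x) | y g x. snd g \<in> gen_group M \<and> (x, y) \<in> ext_graph M L g}"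

definition gpd_top :: "'a::ring_1 set \<Rightarrow> 'a set
      \<Rightarrow> (('a set \<Rightarrow> 'a set) \<times> ('a \<times> 'a) \<times> ('a set \<Rightarrow> 'a set)) topology" where
  "gpd_top M L = subtopology
     (prod_topology (Lbar_top M L)
        (prod_topology (discrete_topology (UNIV \<times> gen_group M)) (Lbar_top M L)))
     (gpd_arrows M L)"

definition gsrc :: "'u \<times> 'g \<times> 'u \<Rightarrow> 'u" where "gsrc \<alpha> = snd (snd \<alpha>)"
definition grng :: "'u \<times> 'g \<times> 'u \<Rightarrow> 'u" where "grng \<alpha> = fst \<alpha>"

text \<open>Product in QR \<rtimes> <M>: (b,u)(c,v) = (b + u c, u v).\<close>
definition gmult :: "'u \<times> ('a::ring_1 \<times> 'a) \<times> 'u \<Rightarrow> 'u \<times> ('a \<times> 'a) \<times> 'u \<Rightarrow> 'u \<times> ('a \<times> 'a) \<times> 'u" where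
  "gmult \<alpha> \<beta> = (fst \<alpha>,
     (fst (fst (snd \<alpha>)) + snd (fst (snd \<alpha>)) * fst (fst (snd \<beta>)),
      snd (fst (snd \<alpha>)) * snd (fst (snd \<beta>))),
     snd (snd \<beta>))"

definition gpd_isomorphic :: "'a::ring_1 set \<Rightarrow> 'a set \<Rightarrow> 'b::ring_1 set \<Rightarrow> 'b set \<Rightarrow> bool" where
  "gpd_isomorphic M1 L1 M2 L2 \<longleftrightarrow> (\<exists>\<Phi>.
     homeomorphic_map (gpd_top M1 L1) (gpd_top M2 L2) \<Phi> \<and>
     (\<forall>\<alpha>\<in>gpd_arrows M1 L1. \<forall>\<beta>\<in>gpd_arrows M1 L1.
        (gsrc \<alpha> = grng \<beta> \<longleftrightarrow> gsrc (\<Phi> \<alpha>) = grng (\<Phi> \<beta>)) \<and>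
        (gsrc \<alpha> = grng \<beta> \<longrightarrow> \<Phi> (gmult \<alpha> \<beta>) = gmult (\<Phi> \<alpha>) (\<Phi> \<beta>))))"

text \<open>Q-algebra isomorphism (Q-linearity follows from additivity between Q-algebras).\<close>
definition qalg_iso :: "('a::ring_1 \<Rightarrow> 'b::ring_1) \<Rightarrow> bool" where
  "qalg_iso \<phi> \<longleftrightarrow> bij \<phi> \<and> (\<forall>x y. \<phi> (x + y) = \<phi> x + \<phi> y)
      \<and> (\<forall>x y. \<phi> (x * y) = \<phi> x * \<phi> y) \<and> \<phi> 1 = 1"

end

theory Submission
  imports Defs
begin

text \<open>
  A groupoid isomorphism is a homeomorphism \<open>\<phi>\<close> of the completions together with a locally constant
  cocycle into the second group. Since the completion is profinite, compactness makes the cocycle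
  constant along cosets of a single constructible subgroup, so on a finite-index subgroup \<open>T\<close> of
  translations it is a homomorphism \<open>h\<close> into the second semidirect product. Every arrow conjugates \<open>h\<close>
  into itself up to finite index, and every group element of the second side arises as the label of
  such an arrow. Conjugating by a translation shows that the linear part \<open>v\<close> of \<open>h\<close> satisfies
  \<open>(1 - v c') (1 - v c) = 0\<close>, and conjugating by arbitrary elements of the acting group \<open>G\<close> turns
  \<open>1 - v c\<close> into a generator of a square-zero two-sided ideal, which vanishes by semisimplicity. Hence
  \<open>h\<close> is an additive map into the translations; its rational extension \<open>H\<close> is bijective and
  intertwines the two linear actions, so conjugation by \<open>H\<close> is the required algebra isomorphism.
\<close>

subsection \<open>Subgroups and ranks\<close>

text \<open>The obstacle is that the groupoid shows the acting groups only through labels of arrows,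
  and a cocycle is a homomorphism only where its dependence on the base point disappears.
  Translations by elements of the constructible subgroup that measures closeness to
  \<open>x0\<close> do not move \<open>x0\<close> out of its coset, so restricting to them removes
  this dependence. The price is that every identity holds only on a subset commensurable with the
  order (\<open>full\<close>); since nonzero integers are invertible in QR, denominators are cleared
  whenever an identity has to hold everywhere.

  All linear parts are reached through isotropy: for \<open>l\<close> in \<open>L\<close> and
  \<open>u\<close> in the group, the affine map with parts \<open>l - u * l\<close> and
  \<open>u\<close> fixes \<open>l\<close>, and every coset of a constructible subgroup contains such
  a point. Hence each \<open>u\<close> labels an arrow with both ends close to the base point, on
  either side of the isomorphism.

  The algebra isomorphism obtained carries one group exactly onto the other, so its inverse serves
  as the second map.\<close>

lemma add_subgroup_zero: "add_subgroup G \<Longrightarrow> 0 \<in> G"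
  and add_subgroup_add: "add_subgroup G \<Longrightarrow> x \<in> G \<Longrightarrow> y \<in> G \<Longrightarrow> x + y \<in> G"
  and add_subgroup_neg: "add_subgroup G \<Longrightarrow> x \<in> G \<Longrightarrow> - x \<in> G"
  by (auto simp: add_subgroup_def)

lemma add_subgroup_diff: "add_subgroup G \<Longrightarrow> x \<in> G \<Longrightarrow> y \<in> G \<Longrightarrow> x - y \<in> G"
  using add_subgroup_add[of G x "- y"] add_subgroup_neg[of G y] by simp

lemma add_subgroup_of_nat: "add_subgroup G \<Longrightarrow> x \<in> G \<Longrightarrow> of_nat n * x \<in> G"
  by (induction n) (auto simp: add_subgroup_zero algebra_simps intro: add_subgroup_add)

lemma add_subgroup_of_int: "add_subgroup G \<Longrightarrow> x \<in> G \<Longrightarrow> of_int n * x \<in> G"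
  by (cases n rule: int_cases2) (auto simp: add_subgroup_of_nat add_subgroup_neg)

lemma add_subgroup_sum: "add_subgroup G \<Longrightarrow> (\<And>i. i \<in> F \<Longrightarrow> f i \<in> G) \<Longrightarrow> sum f F \<in> G"
  by (induction F rule: infinite_finite_induct) (auto simp: add_subgroup_zero intro: add_subgroup_add)

lemma add_subgroup_Int: "add_subgroup G \<Longrightarrow> add_subgroup H \<Longrightarrow> add_subgroup (G \<inter> H)"
  by (auto simp: add_subgroup_def)

lemma zspan_minimal: "S \<subseteq> G \<Longrightarrow> add_subgroup G \<Longrightarrow> zspan S \<subseteq> G"
  unfolding zspan_def by (auto intro!: add_subgroup_sum add_subgroup_of_int)

lemma zspan_superset: "S \<subseteq> zspan S"
proof
  fix s assume "s \<in> S"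
  then show "s \<in> zspan S"
    unfolding zspan_def by (auto intro!: exI[of _ "{s}"] exI[of _ "\<lambda>_. 1"])
qed

lemma add_subgroup_zspan: "add_subgroup (zspan S)"
proof -
  have add: "x + y \<in> zspan S" if x: "x \<in> zspan S" and y: "y \<in> zspan S" for x y
  proof -
    obtain F c where F: "finite F" "F \<subseteq> S" "x = (\<Sum>s\<in>F. of_int (c s) * s)"
      using x unfolding zspan_def by blast
    obtain G d where G: "finite G" "G \<subseteq> S" "y = (\<Sum>s\<in>G. of_int (d s) * s)"
      using y unfolding zspan_def by blast
    have "x = (\<Sum>s\<in>F \<union> G. of_int (if s \<in> F then c s else 0) * s)"
      unfolding F(3) by (rule sum.mono_neutral_cong_left) (use F(1) G(1) in auto)
    moreover have "y = (\<Sum>s\<in>F \<union> G. of_int (if s \<in> G then d s else 0) * s)"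
      unfolding G(3) by (rule sum.mono_neutral_cong_left) (use F(1) G(1) in auto)
    ultimately have "x + y = (\<Sum>s\<in>F \<union> G.
        of_int ((if s \<in> F then c s else 0) + (if s \<in> G then d s else 0)) * s)"
      by (simp add: sum.distrib distrib_right)
    then show ?thesis
      unfolding zspan_def mem_Collect_eq using F(1,2) G(1,2)
      by (intro exI[of _ "F \<union> G"]
          exI[of _ "\<lambda>s. (if s \<in> F then c s else 0) + (if s \<in> G then d s else 0)"]) auto
  qed
  have neg: "- x \<in> zspan S" if x: "x \<in> zspan S" for x
  proof -
    obtain F c where F: "finite F" "F \<subseteq> S" "x = (\<Sum>s\<in>F. of_int (c s) * s)"
      using x unfolding zspan_def by blast
    then have "- x = (\<Sum>s\<in>F. of_int (- c s) * s)" by (simp add: sum_negf)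
    then show ?thesis unfolding zspan_def mem_Collect_eq using F(1,2)
      by (intro exI[of _ F] exI[of _ "\<lambda>s. - c s"]) auto
  qed
  have "0 \<in> zspan S"
    unfolding zspan_def by (auto intro: exI[of _ "{}"])
  then show ?thesis using add neg by (auto simp: add_subgroup_def)
qed

section \<open>Integer and rational scalars in a noncommutative ring\<close>

lemma mult_of_int_of_int: "of_int n * (of_int m * x) = of_int (n * m) * (x::'a::ring_1)"
  by (simp add: mult.assoc)

lemma mult_of_nat_of_nat: "of_nat (n * m) * x = of_nat n * (of_nat m * (x::'a::ring_1))"
  by (simp add: mult.assoc)

lemma mult_of_nat_of_nat': "of_nat (n * m) * x = of_nat m * (of_nat n * (x::'a::ring_1))"
  by (metis mult.commute mult_of_nat_of_nat)

lemma mult_of_nat_left_commute: "x * (of_nat n * y) = of_nat n * (x * (y::'a::ring_1))"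
  by (metis mult.assoc mult_of_nat_commute)

lemma mult_of_int_left_commute: "x * (of_int n * y) = of_int n * (x * (y::'a::ring_1))"
  by (metis mult.assoc mult_of_int_commute)

lemma additive_of_nat:
  assumes "add_subgroup T" "\<And>c c'. c \<in> T \<Longrightarrow> c' \<in> T \<Longrightarrow> f (c + c') = f c + (f c' :: 'b::ring_1)" "c \<in> T"
  shows "f (of_nat n * c) = of_nat n * f c"
proof (induction n)
  case 0
  show ?case using assms(2)[of 0 0] add_subgroup_zero[OF assms(1)] by simp
next
  case (Suc n)
  then show ?case
    using assms(2)[OF assms(3) add_subgroup_of_nat[OF assms(1,3), of n]] by (simp add: distrib_right)
qed

text \<open>A type of class \<open>ring_1\<close> has no division, so the scalar multiple is pinned
  down by clearing the denominator of the reduced fraction. The description is unique once nonzero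
  integers are invertible.\<close>

definition qscale :: "rat \<Rightarrow> 'a::ring_1 \<Rightarrow> 'a" where
  "qscale q x = (THE y. of_int (snd (quotient_of q)) * y = of_int (fst (quotient_of q)) * x)"

locale rational_order =
  fixes R :: "'a::ring_1 set"
  assumes subring: "subring1 R" and fg: "fg_add R" and QR: "is_QR R"
begin

lemma add_subgroup_R: "add_subgroup R"
  and one_R: "1 \<in> R"
  and mult_R: "x \<in> R \<Longrightarrow> y \<in> R \<Longrightarrow> x * y \<in> R"
  using subring by (auto simp: subring1_def)

lemma of_int_inverse: "n \<noteq> 0 \<Longrightarrow> \<exists>y::'a. of_int n * y = 1 \<and> y * of_int n = 1"
  using QR by (auto simp: is_QR_def)

lemma of_int_cancel: "n \<noteq> 0 \<Longrightarrow> of_int n * x = of_int n * (y::'a) \<Longrightarrow> x = y"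
  by (metis mult.assoc mult_1 of_int_inverse)

lemma of_nat_cancel: "n > 0 \<Longrightarrow> of_nat n * x = of_nat n * (y::'a) \<Longrightarrow> x = y"
  using of_int_cancel[of "int n" x y] by simp

lemma of_int_divide: "n \<noteq> 0 \<Longrightarrow> \<exists>y::'a. of_int n * y = x"
  by (metis mult.assoc mult_1 of_int_inverse)

lemma of_nat_divide: "n > 0 \<Longrightarrow> \<exists>y::'a. of_nat n * y = x"
  using of_int_divide[of "int n" x] by simp

lemma clear_denominator: "\<exists>n>0. of_nat n * (x::'a) \<in> R"
proof -
  obtain n :: int where n: "n \<noteq> 0" "of_int n * x \<in> R"
    using QR unfolding is_QR_def by blast
  have "of_nat (nat \<bar>n\<bar>) * x \<in> R"
    using n add_subgroup_neg[OF add_subgroup_R] by (cases "n > 0") fastforce+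
  then show ?thesis using n by (intro exI[of _ "nat \<bar>n\<bar>"]) auto
qed

lemma qscale: "of_int (snd (quotient_of q)) * qscale q x = of_int (fst (quotient_of q)) * (x::'a)"
proof -
  have d: "snd (quotient_of q) \<noteq> 0" using quotient_of_denom_pos'[of q] by simp
  obtain y :: 'a where "of_int (snd (quotient_of q)) * y = of_int (fst (quotient_of q)) * x"
    using of_int_divide[OF d] by blast
  then have "\<exists>!y. of_int (snd (quotient_of q)) * y = of_int (fst (quotient_of q)) * x"
    using of_int_cancel[OF d] by metis
  then show ?thesis unfolding qscale_def by (rule theI')
qed

lemma qscale_repr:
  obtains a b :: int where "b > 0" "q = of_int a / of_int b"
    "\<And>x::'a. of_int b * qscale q x = of_int a * x"
proof (rule that)
  show "snd (quotient_of q) > 0" by (rule quotient_of_denom_pos')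
  show "q = of_int (fst (quotient_of q)) / of_int (snd (quotient_of q))"
    by (rule quotient_of_div) simp
qed (rule qscale)

lemma qscale_eqI:
  assumes "b \<noteq> 0" "of_int b * y = of_int a * (x::'a)" "q = of_int a / of_int b"
  shows "qscale q x = y"
proof -
  obtain p d where pd: "d > 0" "q = of_int p / of_int d" "\<And>x::'a. of_int d * qscale q x = of_int p * x"
    using qscale_repr[of q] by metis
  have "of_int (p * b) = (of_int (a * d) :: rat)"
    using assms(1,3) pd(1,2) by (simp add: field_simps)
  then have pb: "p * b = a * d" by (simp only: of_int_eq_iff)
  have "of_int (b * d) * y = of_int (d * a) * x"
    by (metis assms(2) mult.commute mult_of_int_of_int)
  also have "\<dots> = of_int b * (of_int d * qscale q x)"
    by (metis mult.commute mult_of_int_of_int pb pd(3))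
  also have "\<dots> = of_int (b * d) * qscale q x" by (rule mult_of_int_of_int)
  finally show ?thesis
    using of_int_cancel[of "b * d" "qscale q x" y] assms(1) pd(1) by simp
qed

lemma qscale_of_int: "qscale (of_int n) x = of_int n * (x::'a)"
  by (rule qscale_eqI[of 1 _ n]) auto

lemma vector_space_qscale: "vector_space (qscale :: rat \<Rightarrow> 'a \<Rightarrow> 'a)"
proof
  fix q r :: rat and x y :: 'a
  obtain a b where q: "b > 0" "q = of_int a / of_int b" "\<And>x::'a. of_int b * qscale q x = of_int a * x"
    using qscale_repr[of q] by metis
  obtain c d where r: "d > 0" "r = of_int c / of_int d" "\<And>x::'a. of_int d * qscale r x = of_int c * x"
    using qscale_repr[of r] by metis
  show "qscale q (x + y) = qscale q x + qscale q y"
    by (rule qscale_eqI[of b _ a]) (use q in \<open>auto simp: distrib_left\<close>)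
  show "qscale 1 x = x" using qscale_of_int[of 1 x] by simp
  have "of_int (b * d) * qscale q x = of_int (a * d) * x"
    by (metis mult.commute mult_of_int_of_int q(3))
  moreover have "of_int (b * d) * qscale r x = of_int (b * c) * x"
    by (metis mult_of_int_of_int r(3))
  ultimately have "of_int (b * d) * (qscale q x + qscale r x) = of_int (a * d + b * c) * x"
    by (simp only: distrib_left distrib_right of_int_add)
  moreover have "q + r = of_int (a * d + b * c) / of_int (b * d)"
    using q(1,2) r(1,2) by (simp add: field_simps)
  ultimately show "qscale (q + r) x = qscale q x + qscale r x"
    using q(1) r(1) by (intro qscale_eqI[of "b * d" _ "a * d + b * c"]) simp_all
  have "of_int (b * d) * qscale q (qscale r x) = of_int (a * c) * x"
    by (metis mult.commute mult_of_int_of_int q(3) r(3))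
  then show "qscale q (qscale r x) = qscale (q * r) x"
    using q(1,2) r(1,2) by (intro qscale_eqI[symmetric, of "b * d" _ "a * c"]) auto
qed

text \<open>Multiplying a rational relation by the product of its denominators gives an integral
  one, so integral independence is rational independence and the exchange bound for vector spaces
  applies.\<close>

lemma zindep_card_le:
  assumes "finite T" "zindep S" "S \<subseteq> zspan (T::'a set)"
  shows "card S \<le> card T"
proof -
  interpret Q: vector_space "qscale :: rat \<Rightarrow> 'a \<Rightarrow> 'a" by (rule vector_space_qscale)
  have "Q.independent S"
    unfolding Q.independent_explicit_finite_subsets
  proof (intro allI impI ballI)
    fix F u v assume F: "F \<subseteq> S" "finite F" "(\<Sum>v\<in>F. qscale (u v) v) = 0" "v \<in> F"
    define d where "d s = snd (quotient_of (u s))" for s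
    define p where "p s = fst (quotient_of (u s))" for s
    have d: "d s \<noteq> 0" for s using quotient_of_denom_pos'[of "u s"] by (simp add: d_def)
    define D where "D = (\<Prod>s\<in>F. d s)"
    define c where "c s = p s * (D div d s)" for s
    have "of_int D * qscale (u s) s = of_int (c s) * s" if "s \<in> F" for s
    proof -
      have "d s dvd D" unfolding D_def using that F(2) by (rule dvd_prodI[rotated])
      then have D: "D = (D div d s) * d s" by simp
      show ?thesis
        using qscale[of "u s" s] unfolding c_def p_def d_def
        by (metis D d_def mult.commute mult_of_int_of_int)
    qed
    then have "(\<Sum>s\<in>F. of_int (c s) * s) = of_int D * (\<Sum>s\<in>F. qscale (u s) s)"
      by (simp add: sum_distrib_left)
    then have "(\<Sum>s\<in>F. of_int (c s) * s) = 0" using F(3) by simp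
    then have "c v = 0" using assms(2) F unfolding zindep_def by blast
    moreover have "D div d v \<noteq> 0"
    proof -
      have "d v dvd D" unfolding D_def using F(4,2) by (rule dvd_prodI[rotated])
      moreover have "D \<noteq> 0" unfolding D_def using d F(2) by simp
      ultimately show ?thesis using d by (simp add: dvd_div_eq_0_iff)
    qed
    ultimately have "p v = 0" by (simp add: c_def)
    then show "u v = 0"
      using quotient_of_div[of "u v" "p v" "d v"] by (simp add: p_def d_def prod_eq_iff)
  qed
  moreover have "zspan T \<subseteq> Q.span T"
  proof (rule zspan_minimal)
    show "add_subgroup (Q.span T)"
      unfolding add_subgroup_def
      using Q.span_zero Q.span_add Q.span_neg by blast
  qed (rule Q.span_superset)
  ultimately show ?thesis
    using Q.independent_span_bound[OF assms(1)] assms(3) by blast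
qed

text \<open>\<open>zrank\<close> is a \<open>Max\<close>, which says something only about a finite
  nonempty set.\<close>

lemma finite_zindep_cards:
  assumes "G \<subseteq> R"
  shows "finite {card S | S. finite S \<and> S \<subseteq> G \<and> zindep S}"
proof -
  obtain T where "finite T" "R = zspan T" using fg by (auto simp: fg_add_def)
  then have "{card S | S. finite S \<and> S \<subseteq> G \<and> zindep S} \<subseteq> {..card T}"
    using zindep_card_le[of T] assms by auto
  then show ?thesis by (rule finite_subset) simp
qed

lemma zrank_attained:
  assumes "G \<subseteq> R"
  obtains B where "finite B" "B \<subseteq> G" "zindep B" "card B = zrank G"
proof -
  have "zindep ({}::'a set)" by (auto simp: zindep_def)
  then have "{card S | S. finite S \<and> S \<subseteq> G \<and> zindep S} \<noteq> {}" by blast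
  from Max_in[OF finite_zindep_cards[OF assms] this] show thesis
    using that unfolding zrank_def by auto
qed

text \<open>By maximality, adding \<open>x\<close> to \<open>B\<close> creates an integral relation.
  Independence of \<open>B\<close> forces its coefficient at \<open>x\<close> to be nonzero, and
  this coefficient is the multiplier.\<close>

lemma multiple_in_zspan_of_maximal_rank:
  assumes B: "finite B" "B \<subseteq> R" "zindep B" "card B = zrank R" and x: "x \<in> R"
  shows "\<exists>n. n \<noteq> 0 \<and> of_int n * x \<in> zspan B"
proof (cases "x \<in> B")
  case True
  then have "of_int 1 * x \<in> zspan B" using zspan_superset by auto
  then show ?thesis using one_neq_zero by blast
next
  case False
  have "\<not> zindep (insert x B)"
  proof
    assume "zindep (insert x B)"
    then have "card (insert x B) \<le> zrank R"
      unfolding zrank_def using B x by (intro Max_ge finite_zindep_cards) auto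
    then show False using B False by simp
  qed
  then obtain F c t where F: "finite F" "F \<subseteq> insert x B" "(\<Sum>s\<in>F. of_int (c s) * s) = 0"
      "t \<in> F" "c t \<noteq> (0::int)"
    unfolding zindep_def by blast
  have sum: "(\<Sum>s\<in>F - {x}. of_int (c s) * s) \<in> zspan B"
    unfolding zspan_def using F(1,2) by auto
  have "x \<in> F \<and> c x \<noteq> 0"
  proof (rule ccontr)
    assume n: "\<not> (x \<in> F \<and> c x \<noteq> 0)"
    then have "(\<Sum>s\<in>F - {x}. of_int (c s) * s) = (\<Sum>s\<in>F. of_int (c s) * s)"
      using F(1) by (intro sum.mono_neutral_left) auto
    moreover have "finite (F - {x})" "F - {x} \<subseteq> B" "t \<in> F - {x}" using F n by auto
    ultimately show False using B(3) F(3,5) unfolding zindep_def by metis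
  qed
  moreover from this have "of_int (c x) * x = - (\<Sum>s\<in>F - {x}. of_int (c s) * s)"
    using F(1,3) by (simp add: sum.remove[of F x] eq_neg_iff_add_eq_0)
  ultimately show ?thesis
    using add_subgroup_neg[OF add_subgroup_zspan sum] by metis
qed

text \<open>Finite-index subgroups enter only through this commensurability with the order.\<close>

definition full :: "'a set \<Rightarrow> bool" where
  "full P \<longleftrightarrow> (\<exists>n>0. \<forall>r\<in>R. of_nat n * r \<in> P)"

lemma full_mono: "full P \<Longrightarrow> P \<subseteq> Q \<Longrightarrow> full Q"
  unfolding full_def by blast

lemma full_Int:
  assumes "full P" "full Q"
  shows "full (P \<inter> Q)"
proof -
  obtain n m where n: "n > 0" "\<forall>r\<in>R. of_nat n * r \<in> P" and m: "m > 0" "\<forall>r\<in>R. of_nat m * r \<in> Q"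
    using assms unfolding full_def by blast
  have "of_nat (n * m) * r \<in> P \<inter> Q" if "r \<in> R" for r
  proof -
    have "of_nat (n * m) * r \<in> P" unfolding mult_of_nat_of_nat
      using n(2) add_subgroup_of_nat[OF add_subgroup_R that] by blast
    moreover have "of_nat (n * m) * r \<in> Q" unfolding mult_of_nat_of_nat'
      using m(2) add_subgroup_of_nat[OF add_subgroup_R that] by blast
    ultimately show ?thesis by blast
  qed
  then show ?thesis unfolding full_def using n(1) m(1) by (intro exI[of _ "n * m"]) auto
qed

text \<open>The denominator of \<open>u\<close> is absorbed into the multiplier, so \<open>u\<close>
  may be any element of QR. This is what allows restricting to those \<open>c\<close> for which
  \<open>u * c\<close> still lies in a given subgroup.\<close>

lemma full_preimage:
  assumes "full P"
  shows "full {x. u * x \<in> P}"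
proof -
  obtain n where n: "n > 0" "\<forall>r\<in>R. of_nat n * r \<in> P"
    using assms unfolding full_def by blast
  obtain m where m: "m > 0" "of_nat m * u \<in> R" using clear_denominator by blast
  have "u * (of_nat (n * m) * r) \<in> P" if "r \<in> R" for r
  proof -
    have "u * (of_nat (n * m) * r) = of_nat n * (of_nat m * u * r)"
      by (simp only: mult_of_nat_left_commute[of u] mult_of_nat_of_nat mult.assoc)
    then show ?thesis using n(2) mult_R[OF m(2) that] by simp
  qed
  then show ?thesis unfolding full_def using n(1) m(1) by (intro exI[of _ "n * m"]) auto
qed

lemma full_multiple:
  assumes "full P"
  shows "\<exists>n>0. of_nat n * (x::'a) \<in> P"
proof -
  obtain n where n: "n > 0" "\<forall>r\<in>R. of_nat n * r \<in> P"
    using assms unfolding full_def by blast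
  obtain m where m: "m > 0" "of_nat m * x \<in> R" using clear_denominator by blast
  have "of_nat (n * m) * x \<in> P" using n(2) m(2) by (simp add: mult.assoc)
  then show ?thesis using n(1) m(1) by (intro exI[of _ "n * m"]) auto
qed

text \<open>Finite generation makes the multiplier uniform: the product of the multipliers of the
  generators works for all of \<open>R\<close>.\<close>

lemma full_if_multiples:
  assumes P: "add_subgroup P" and mult: "\<And>x. x \<in> R \<Longrightarrow> \<exists>n. n \<noteq> 0 \<and> of_int n * x \<in> P"
  shows "full P"
proof -
  obtain T where T: "finite T" "T \<subseteq> R" "R = zspan T" using fg by (auto simp: fg_add_def)
  obtain f where f: "\<And>x. x \<in> R \<Longrightarrow> f x \<noteq> 0 \<and> of_int (f x) * x \<in> P" using mult by metis
  define n where "n = (\<Prod>t\<in>T. nat \<bar>f t\<bar>)"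
  have "of_nat n * t \<in> P" if "t \<in> T" for t
  proof -
    have "nat \<bar>f t\<bar> dvd n" unfolding n_def using that T(1) by (rule dvd_prodI[rotated])
    then obtain k where "n = nat \<bar>f t\<bar> * k" by blast
    then have "of_nat n = of_int \<bar>f t\<bar> * (of_nat k :: 'a)" by simp
    \<comment> \<open>The multiplier was built from absolute values to be positive; the sign
      restores the element known to lie in \<open>P\<close>.\<close>
    then have "of_nat n * t = of_nat k * (of_int (sgn (f t)) * (of_int (f t) * t))"
      by (metis abs_sgn mult.assoc mult.commute mult_of_nat_commute of_int_mult)
    then show ?thesis
      using f that T(2) add_subgroup_of_nat[OF P] add_subgroup_of_int[OF P] by auto
  qed
  moreover have "add_subgroup {x. of_nat n * x \<in> P}"
    using P by (auto simp: add_subgroup_def distrib_left)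
  ultimately have "R \<subseteq> {x. of_nat n * x \<in> P}"
    unfolding T(3) by (intro zspan_minimal) auto
  moreover have "n > 0" unfolding n_def using f T(1,2) by (auto intro!: prod_pos)
  ultimately show ?thesis unfolding full_def by blast
qed

lemma full_of_zrank:
  assumes "add_subgroup P" "P \<subseteq> R" "zrank P = zrank R"
  shows "full P"
proof (rule full_if_multiples[OF assms(1)])
  obtain B where B: "finite B" "B \<subseteq> P" "zindep B" "card B = zrank P"
    using zrank_attained[OF assms(2)] .
  fix x assume "x \<in> R"
  moreover have "zspan B \<subseteq> P" using B(2) assms(1) by (rule zspan_minimal)
  ultimately show "\<exists>n. n \<noteq> 0 \<and> of_int n * x \<in> P"
    using multiple_in_zspan_of_maximal_rank[of B x] B assms by (metis subset_iff subset_trans)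
qed

section \<open>Left regular elements as units of QR\<close>

lemma left_regular_cancel:
  assumes "a \<in> left_regular R" "a * x = a * y"
  shows "x = y"
proof -
  obtain n m where n: "n > 0" "of_nat n * x \<in> R" and m: "m > 0" "of_nat m * y \<in> R"
    using clear_denominator by meson
  \<comment> \<open>Left regularity is tested only inside \<open>R\<close>, so both elements are
    first moved there by a common multiplier.\<close>
  let ?k = "n * m"
  have "of_nat ?k * x \<in> R" "of_nat ?k * y \<in> R"
    using add_subgroup_of_nat[OF add_subgroup_R n(2), of m]
      add_subgroup_of_nat[OF add_subgroup_R m(2), of n]
    by (simp_all only: mult_of_nat_of_nat'[of n m x] mult_of_nat_of_nat[of n m y])
  moreover have "a * (of_nat ?k * x) = a * (of_nat ?k * y)"
    by (simp only: mult_of_nat_left_commute assms(2))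
  ultimately have "of_nat ?k * x = of_nat ?k * y"
    using assms(1) unfolding left_regular_def by blast
  then show ?thesis using of_nat_cancel[of ?k x y] n(1) m(1) by simp
qed

text \<open>An injective linear map of a finite-dimensional space is onto. In terms of ranks:
  \<open>a\<close> maps a maximal independent set to an independent set of the same size, whose span
  therefore contains a nonzero integer; this gives a right inverse. Cancelling \<open>a\<close>
  makes it two-sided.\<close>

lemma left_regular_invertible:
  assumes a: "a \<in> left_regular R"
  shows "\<exists>v. a * v = 1 \<and> v * a = 1"
proof -
  have aR: "a \<in> R" using a by (simp add: left_regular_def)
  obtain B where B: "finite B" "B \<subseteq> R" "zindep B" "card B = zrank R"
    using zrank_attained[OF order_refl] .
  have inj: "inj_on ((*) a) S" for S using left_regular_cancel[OF a] by (auto simp: inj_on_def)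
  have "zindep ((*) a ` B)"
    unfolding zindep_def
  proof (intro allI impI ballI)
    fix F c s assume F: "finite F" "F \<subseteq> (*) a ` B" "(\<Sum>s\<in>F. of_int (c s) * s) = 0" "s \<in> F"
    then obtain G where G: "G \<subseteq> B" "F = (*) a ` G" by (auto simp: subset_image_iff)
    have fG: "finite G" using F(1) unfolding G(2) by (rule finite_imageD) (rule inj)
    have "(\<Sum>s\<in>F. of_int (c s) * s) = (\<Sum>s\<in>G. of_int (c (a * s)) * (a * s))"
      unfolding G(2) by (simp add: sum.reindex[OF inj])
    also have "\<dots> = a * (\<Sum>s\<in>G. of_int (c (a * s)) * s)"
      unfolding sum_distrib_left by (simp only: mult_of_int_left_commute)
    finally have "(\<Sum>s\<in>G. of_int (c (a * s)) * s) = 0"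
      using left_regular_cancel[OF a, of _ 0] F(3) by simp
    then have "\<forall>s\<in>G. c (a * s) = 0"
      using B(3) fG G(1) unfolding zindep_def by (elim allE[of _ G] allE[of _ "\<lambda>s. c (a * s)"]) auto
    then show "c s = 0" using F(4) G(2) by auto
  qed
  moreover have "card ((*) a ` B) = zrank R" using B(4) by (simp add: card_image[OF inj])
  moreover have "(*) a ` B \<subseteq> R" using B(2) mult_R[OF aR] by auto
  ultimately have "\<exists>n. n \<noteq> 0 \<and> of_int n * 1 \<in> zspan ((*) a ` B)"
    using B(1) one_R by (intro multiple_in_zspan_of_maximal_rank) auto
  then obtain n where n: "n \<noteq> 0" "of_int n * 1 \<in> zspan ((*) a ` B)" by blast
  have "add_subgroup (range ((*) a))"
    unfolding add_subgroup_def
  proof (intro conjI ballI)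
    show "0 \<in> range ((*) a)" using rangeI[of "(*) a" 0] by simp
    fix x y assume "x \<in> range ((*) a)" "y \<in> range ((*) a)"
    then obtain s t where "x = a * s" "y = a * t" by blast
    then show "x + y \<in> range ((*) a)" "- x \<in> range ((*) a)"
      using rangeI[of "(*) a" "s + t"] rangeI[of "(*) a" "- s"] by (simp_all add: distrib_left)
  qed
  then have "zspan ((*) a ` B) \<subseteq> range ((*) a)" by (intro zspan_minimal) auto
  then obtain r where r: "of_int n = a * r" using n(2) by auto
  obtain y :: 'a where y: "of_int n * y = 1" using of_int_inverse[OF n(1)] by blast
  have 1: "a * (r * y) = 1" using r y by (simp add: mult.assoc)
  have "a * (r * y * a) = a * 1" using 1 by (simp add: mult.assoc[symmetric])
  then show ?thesis using left_regular_cancel[OF a] 1 by blast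
qed

end

subsection \<open>The completion and its partial transformation groupoid\<close>

lemma mem_coset: "x \<in> coset a C \<longleftrightarrow> x - a \<in> C"
proof
  assume "x - a \<in> C"
  then show "x \<in> coset a C" unfolding coset_def by (rule rev_image_eqI) simp
qed (auto simp: coset_def)

lemma coset_eq_iff:
  assumes C: "add_subgroup C"
  shows "coset a C = coset b C \<longleftrightarrow> a - b \<in> C"
proof
  assume "coset a C = coset b C"
  then show "a - b \<in> C" using add_subgroup_zero[OF C] by (metis diff_self mem_coset)
next
  assume ab: "a - b \<in> C"
  have "x - a \<in> C \<longleftrightarrow> x - b \<in> C" for x
    using add_subgroup_add[OF C _ ab, of "x - a"] add_subgroup_diff[OF C _ ab, of "x - b"] by auto
  then show "coset a C = coset b C" by (auto simp: mem_coset)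
qed

lemma coset_mono: "C \<subseteq> D \<Longrightarrow> coset a C \<subseteq> coset a D"
  by (auto simp: coset_def)

lemma coset_coset: "coset a (coset b C) = coset (a + b) C"
  by (auto simp: coset_def image_image add.assoc)

definition act :: "'a::ring_1 \<times> 'a \<Rightarrow> 'a \<Rightarrow> 'a" where
  "act g x = fst g + snd g * x"

definition gdot :: "'a::ring_1 \<times> 'a \<Rightarrow> 'a \<times> 'a \<Rightarrow> 'a \<times> 'a" where
  "gdot g h = (fst g + snd g * fst h, snd g * snd h)"

lemma gmult_eq: "gmult (z, g, y') (y, h, x) = (z, gdot g h, x)"
  by (simp add: gmult_def gdot_def)

lemma gdot_assoc: "gdot (gdot f g) h = gdot f (gdot g h)"
  by (simp add: gdot_def algebra_simps)

lemma gdot_one: "gdot (0, 1) g = g" "gdot g (0, 1) = g"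
  by (simp_all add: gdot_def)

lemma act_gdot: "act (gdot g h) x = act g (act h x)"
  by (simp add: act_def gdot_def algebra_simps)

definition translate :: "'a::ring_1 \<Rightarrow> ('a set \<Rightarrow> 'a set) \<Rightarrow> ('a set \<Rightarrow> 'a set)" where
  "translate b \<xi> = (\<lambda>C. coset b (\<xi> C))"

lemma translate_translate: "translate a (translate b \<xi>) = translate (a + b) \<xi>"
  by (simp add: translate_def coset_coset)

lemma translate_zero: "translate 0 \<xi> = \<xi>"
  by (simp add: translate_def coset_def)

locale algebraic_system = rational_order R
  for R :: "'a::ring_1 set" +
  fixes L M :: "'a set"
  assumes L_subgroup: "add_subgroup L" and L_R: "L \<subseteq> R" and L_rank: "zrank L = zrank R"
    and M_submonoid: "submonoid M" and M_regular: "M \<subseteq> left_regular R"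
    and M_L: "\<forall>a\<in>M. \<forall>x\<in>L. a * x \<in> L"
    and M_span: "finite_index (zspan M) R"
    and semisimple: "(jacobson_radical :: 'a set) = {0}"
begin

abbreviation "con \<equiv> constructible M L"
abbreviation "X \<equiv> Lbar M L"
abbreviation "G \<equiv> gen_group M"
abbreviation "arrows \<equiv> gpd_arrows M L"

section \<open>Constructible subgroups\<close>

lemma M_cancel: "a \<in> M \<Longrightarrow> a * x = a * y \<Longrightarrow> x = y"
  using M_regular left_regular_cancel by blast

lemma full_L: "full L"
  using L_subgroup L_R L_rank by (rule full_of_zrank)

lemma con_props: "C \<in> con \<Longrightarrow> add_subgroup C \<and> C \<subseteq> L \<and> full C"
proof (induction rule: constructible.induct)
  case base
  then show ?case using L_subgroup full_L by simp
next
  case (img C a)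
  have "add_subgroup ((*) a ` C)"
    unfolding add_subgroup_def
  proof (intro conjI ballI)
    show "0 \<in> (*) a ` C"
      using img.IH add_subgroup_zero[of C] image_eqI[of 0 "(*) a" 0 C] by simp
    fix x y assume "x \<in> (*) a ` C" "y \<in> (*) a ` C"
    then obtain s t where st: "x = a * s" "y = a * t" "s \<in> C" "t \<in> C" by blast
    then have "s + t \<in> C" "- s \<in> C"
      using img.IH by (auto intro: add_subgroup_add add_subgroup_neg)
    then show "x + y \<in> (*) a ` C" "- x \<in> (*) a ` C"
      using st by (auto simp: distrib_left intro: rev_image_eqI)
  qed
  moreover have "(*) a ` C \<subseteq> L" using img M_L by auto
  moreover have "full ((*) a ` C)"
  proof -
    \<comment> \<open>With \<open>a\<close> invertible in QR, an image under \<open>a\<close> is a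
      preimage under its inverse, so \<open>full_preimage\<close> covers this case too.\<close>
    obtain v where v: "a * v = 1" using left_regular_invertible M_regular img.hyps(2) by blast
    have "{x. v * x \<in> C} \<subseteq> (*) a ` C"
    proof
      fix x assume "x \<in> {x. v * x \<in> C}"
      then show "x \<in> (*) a ` C"
        using v by (intro rev_image_eqI[of "v * x"]) (auto simp: mult.assoc[symmetric])
    qed
    then show ?thesis using full_preimage[of C v] img.IH full_mono by blast
  qed
  ultimately show ?case by simp
next
  case (pre C a)
  have "add_subgroup {x \<in> L. a * x \<in> C}"
    using pre.IH L_subgroup by (auto simp: add_subgroup_def distrib_left)
  moreover have "full (L \<inter> {x. a * x \<in> C})"
    using pre.IH full_L by (intro full_Int full_preimage) auto
  ultimately show ?case by (auto simp: Int_def)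
qed

lemma con_subgroup: "C \<in> con \<Longrightarrow> add_subgroup C"
  and con_L: "C \<in> con \<Longrightarrow> C \<subseteq> L"
  and con_full: "C \<in> con \<Longrightarrow> full C"
  using con_props by auto

text \<open>Intersection is not a generating operation. The outermost operation of \<open>C\<close>
  can be pulled out if the opposite operation is applied to \<open>D\<close>, which keeps
  \<open>D\<close> constructible; hence the induction lets \<open>D\<close> vary. The preimage case
  relies on injectivity of \<open>a\<close>.\<close>

lemma con_Int:
  assumes "C \<in> con" "D \<in> con"
  shows "C \<inter> D \<in> con"
  using assms
proof (induction arbitrary: D rule: constructible.induct)
  case base
  then show ?case using con_L[of D] by (simp add: Int_absorb1)
next
  case (img C a)
  have "(*) a ` C \<inter> D = (*) a ` (C \<inter> {x \<in> L. a * x \<in> D})"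
    using con_L[OF img.hyps(1)] by auto
  then show ?case using img by (simp add: constructible.img constructible.pre)
next
  case (pre C a)
  have "{x \<in> L. a * x \<in> C} \<inter> D = {x \<in> L. a * x \<in> C \<inter> (*) a ` D}"
    using con_L[OF pre.prems] M_cancel[OF pre.hyps(2)] by auto
  then show ?case using pre by (simp only: constructible.img constructible.pre)
qed

lemma con_finite_Inter:
  assumes "finite F" "F \<subseteq> con"
  shows "\<exists>C\<in>con. \<forall>D\<in>F. C \<subseteq> D"
  using assms
proof (induction rule: finite_induct)
  case empty
  then show ?case using constructible.base by blast
next
  case (insert D F)
  then obtain C where "C \<in> con" "\<forall>D\<in>F. C \<subseteq> D" by auto
  then show ?case using con_Int[of C D] insert.prems by (intro bexI[of _ "C \<inter> D"]) auto
qed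

text \<open>Some multiple \<open>n\<close> of \<open>R\<close> lies in \<open>C\<close>, so reducing
  the coefficients of an expansion in generators modulo \<open>n\<close> does not change the coset,
  and only finitely many coefficient vectors remain.\<close>

lemma finite_cosets:
  assumes "C \<in> con"
  shows "finite {coset a C | a. a \<in> L}"
proof -
  note C = con_subgroup[OF assms]
  obtain n where n: "n > 0" "\<forall>r\<in>R. of_nat n * r \<in> C"
    using con_full[OF assms] unfolding full_def by blast
  obtain T where T: "finite T" "T \<subseteq> R" "R = zspan T" using fg by (auto simp: fg_add_def)
  define rep where "rep c = coset (\<Sum>t\<in>T. of_int (c t) * t) C" for c :: "'a \<Rightarrow> int"
  have "{coset a C | a. a \<in> L} \<subseteq> rep ` (T \<rightarrow>\<^sub>E {0..<int n})"
  proof clarify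
    fix a assume "a \<in> L"
    then obtain F c where F: "finite F" "F \<subseteq> T" "a = (\<Sum>t\<in>F. of_int (c t) * t)"
      using L_R unfolding T(3) zspan_def by blast
    define d where "d t = (if t \<in> F then c t else 0)" for t
    have a: "a = (\<Sum>t\<in>T. of_int (d t) * t)"
      unfolding F(3) d_def by (rule sum.mono_neutral_cong_left) (use F(2) T(1) in auto)
    define e where "e = restrict (\<lambda>t. d t mod int n) T"
    have "a - (\<Sum>t\<in>T. of_int (e t) * t) = (\<Sum>t\<in>T. of_nat n * (of_int (d t div int n) * t))"
      unfolding a sum_subtractf[symmetric]
    proof (rule sum.cong)
      fix t assume "t \<in> T"
      have "d t - d t mod int n = int n * (d t div int n)"
        by (simp add: minus_mod_eq_mult_div)
      then have "of_int (d t) - of_int (d t mod int n) = (of_nat n * of_int (d t div int n) :: 'a)"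
        by (metis of_int_diff of_int_mult of_int_of_nat_eq)
      then show "of_int (d t) * t - of_int (e t) * t = of_nat n * (of_int (d t div int n) * t)"
        using \<open>t \<in> T\<close> by (simp add: e_def left_diff_distrib[symmetric] mult.assoc)
    qed simp
    moreover have "\<dots> \<in> C"
      using n(2) T(2) add_subgroup_of_int[OF add_subgroup_R] by (intro add_subgroup_sum[OF C]) auto
    ultimately have "coset a C = rep e" unfolding rep_def by (simp add: coset_eq_iff[OF C])
    moreover have "e \<in> T \<rightarrow>\<^sub>E {0..<int n}" using n(1) by (auto simp: e_def)
    ultimately show "coset a C \<in> rep ` (T \<rightarrow>\<^sub>E {0..<int n})" by blast
  qed
  then show ?thesis by (rule finite_subset) (use T(1) in \<open>auto intro!: finite_PiE\<close>)
qed

text \<open>Continuity at 0 of multiplication by a group element. A generator pulls \<open>D\<close>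
  back to a preimage, the inverse of a generator to an image, and both are constructible.\<close>

lemma G_con:
  assumes "u \<in> G" "D \<in> con"
  shows "\<exists>C\<in>con. \<forall>x\<in>C. u * x \<in> D"
  using assms
proof (induction arbitrary: D rule: gen_group.induct)
  case one
  then show ?case by auto
next
  case (gen m)
  then show ?case
    using constructible.pre[of D M L m] by (intro bexI[of _ "{x \<in> L. m * x \<in> D}"]) auto
next
  case (inv m v)
  then show ?case
    using constructible.img[of D M L m] by (intro bexI[of _ "(*) m ` D"]) (auto simp: mult.assoc[symmetric])
next
  case (mult x y)
  then obtain C where C: "C \<in> con" "\<forall>z\<in>C. x * z \<in> D" by blast
  then obtain C' where "C' \<in> con" "\<forall>z\<in>C'. y * z \<in> C" using mult by blast
  then show ?case using C by (intro bexI[of _ C']) (auto simp: mult.assoc)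
qed

lemma G_cancel: "u \<in> G \<Longrightarrow> u * x = u * y \<Longrightarrow> x = y"
proof (induction arbitrary: x y rule: gen_group.induct)
  case one
  then show ?case by simp
next
  case (gen m)
  then show ?case by (rule M_cancel)
next
  case (inv m v)
  then show ?case by (metis mult.assoc mult_1)
next
  case (mult u v)
  have "u * (v * x) = u * (v * y)" using mult.prems by (simp only: mult.assoc)
  then show ?case by (rule mult.IH(2)[OF mult.IH(1)])
qed

section \<open>Points, topology and compactness of the completion\<close>

lemma X_coset:
  assumes "\<xi> \<in> X" "C \<in> con"
  obtains a where "a \<in> L" "\<xi> C = coset a C"
proof -
  have "\<exists>a\<in>L. \<xi> C = coset a C" using assms by (simp add: Lbar_def)
  then show thesis using that by blast
qed

lemma X_outside: "\<xi> \<in> X \<Longrightarrow> C \<notin> con \<Longrightarrow> \<xi> C = {}"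
  and X_mono: "\<xi> \<in> X \<Longrightarrow> C \<in> con \<Longrightarrow> D \<in> con \<Longrightarrow> C \<subseteq> D \<Longrightarrow> \<xi> C \<subseteq> \<xi> D"
  unfolding Lbar_def by auto

lemma X_coset_mono:
  assumes \<xi>: "\<xi> \<in> X" and C: "C \<in> con" and D: "D \<in> con" and CD: "C \<subseteq> D" and a: "\<xi> C = coset a C"
  shows "\<xi> D = coset a D"
proof -
  obtain b where b: "\<xi> D = coset b D" using X_coset[OF \<xi> D] .
  have "a \<in> \<xi> C" using a add_subgroup_zero[OF con_subgroup[OF C]] by (simp add: mem_coset)
  then have "a - b \<in> D" using X_mono[OF \<xi> C D CD] b by (auto simp: mem_coset)
  then show ?thesis using b coset_eq_iff[OF con_subgroup[OF D]] by metis
qed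

lemma X_agree_mono:
  assumes "\<xi> \<in> X" "\<eta> \<in> X" "C \<in> con" "D \<in> con" "C \<subseteq> D" "\<xi> C = \<eta> C"
  shows "\<xi> D = \<eta> D"
proof -
  obtain a where "\<xi> C = coset a C" using X_coset assms by metis
  then show ?thesis using X_coset_mono[of \<xi> C D a] X_coset_mono[of \<eta> C D a] assms by simp
qed

lemma lemb_X: "a \<in> L \<Longrightarrow> lemb M L a \<in> X"
  by (auto simp: Lbar_def lemb_def intro: coset_mono dest: subsetD[OF coset_mono])

lemma translate_X:
  assumes "a \<in> L" "\<xi> \<in> X"
  shows "translate a \<xi> \<in> X"
proof -
  have "\<exists>b\<in>L. translate a \<xi> C = coset b C" if "C \<in> con" for C
    using X_coset[OF assms(2) that] add_subgroup_add[OF L_subgroup assms(1)]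
    by (metis coset_coset translate_def)
  then show ?thesis
    using X_outside[OF assms(2)] X_mono[OF assms(2)]
    by (fastforce simp: Lbar_def translate_def coset_def)
qed

lemma translate_agree:
  assumes "C \<in> con" "c \<in> C" "\<xi> \<in> X"
  shows "translate c \<xi> C = \<xi> C"
proof -
  obtain a where a: "\<xi> C = coset a C" using X_coset[OF assms(3,1)] .
  have "coset (c + a) C = coset a C"
    using assms(2) by (simp add: coset_eq_iff[OF con_subgroup[OF assms(1)]])
  then show ?thesis by (simp add: translate_def a coset_coset)
qed

lemma topspace_Lbar_top: "topspace (Lbar_top M L) = X"
  unfolding Lbar_top_def topology_generated_by_topspace using constructible.base by auto

lemma openin_Lbar_basic: "C \<in> con \<Longrightarrow> openin (Lbar_top M L) {\<xi> \<in> X. \<xi> C = Y}"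
  unfolding Lbar_top_def by (intro topology_generated_by_Basis) auto

text \<open>Finitely many subbasic conditions follow from a single one, at the intersection of the
  subgroups involved, so one \<open>C\<close> always describes a neighbourhood.\<close>

lemma Lbar_top_nbhd:
  assumes "openin (Lbar_top M L) U" "x \<in> U"
  shows "\<exists>C\<in>con. \<forall>y\<in>X. y C = x C \<longrightarrow> y \<in> U"
proof -
  have "x \<in> X" using assms openin_subset topspace_Lbar_top by blast
  have "generate_topology_on {{\<xi> \<in> X. \<xi> C = Y} | C Y. C \<in> con} U"
    using assms(1) unfolding Lbar_top_def by (rule openin_topology_generated_by)
  then show ?thesis using assms(2)
  proof (induction)
    case (Int U V)
    then obtain C D where C: "C \<in> con" "\<forall>y\<in>X. y C = x C \<longrightarrow> y \<in> U"
      and D: "D \<in> con" "\<forall>y\<in>X. y D = x D \<longrightarrow> y \<in> V" by blast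
    note CD = con_Int[OF C(1) D(1)]
    have "y \<in> U \<inter> V" if "y \<in> X" "y (C \<inter> D) = x (C \<inter> D)" for y
      using X_agree_mono[OF \<open>y \<in> X\<close> \<open>x \<in> X\<close> CD C(1) _ that(2)]
        X_agree_mono[OF \<open>y \<in> X\<close> \<open>x \<in> X\<close> CD D(1) _ that(2)] C(2) D(2) \<open>y \<in> X\<close> by simp
    then show ?case using CD by blast
  next
    case (UN K)
    then obtain k where k: "k \<in> K" "x \<in> k" by blast
    then obtain C where "C \<in> con" "\<forall>y\<in>X. y C = x C \<longrightarrow> y \<in> k" using UN.IH by blast
    then show ?case using k(1) by blast
  next
    case (Basis B)
    then obtain C Y where "C \<in> con" "B = {\<xi> \<in> X. \<xi> C = Y}" by blast
    then show ?case using Basis.prems by (intro bexI[of _ C]) auto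
  qed simp
qed

text \<open>Compactness in the form in which it is used: a choice of neighbourhoods, one per point,
  has a finite subcover. By Tychonoff a product of finite discrete coset spaces is compact, and the
  completion is closed in it.\<close>

lemma X_cover:
  assumes N: "\<And>x. x \<in> X \<Longrightarrow> N x \<in> con"
  shows "\<exists>F. finite F \<and> F \<subseteq> X \<and> (\<forall>\<xi>\<in>X. \<exists>x\<in>F. \<xi> (N x) = x (N x))"
proof -
  \<comment> \<open>Coordinates outside \<open>con\<close> get the one-point factor that matches the
    default value \<open>{}\<close> in \<open>Lbar\<close>.\<close>
  define Q where "Q C = (if C \<in> con then {coset a C | a. a \<in> L} else {{}})" for C
  define P where "P = product_topology (\<lambda>C. discrete_topology (Q C)) UNIV"
  have topP: "topspace P = {\<xi>. \<forall>C. \<xi> C \<in> Q C}"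
    by (auto simp: P_def PiE_def)
  have open_basic: "openin P {\<eta> \<in> topspace P. \<eta> C \<in> A}" for C A
  proof -
    have "openin P {\<eta> \<in> topspace P. \<eta> C \<in> A \<inter> Q C}"
      unfolding P_def
      by (rule openin_continuous_map_preimage[OF continuous_map_product_projection]) auto
    moreover have "{\<eta> \<in> topspace P. \<eta> C \<in> A \<inter> Q C} = {\<eta> \<in> topspace P. \<eta> C \<in> A}"
      using topP by auto
    ultimately show ?thesis by simp
  qed
  have "compact_space P"
    unfolding P_def compact_space_product_topology
    by (auto simp: compact_space_discrete_topology Q_def finite_cosets)
  have sub: "X \<subseteq> topspace P" unfolding topP by (fastforce simp: Q_def Lbar_def)
  have "openin P (topspace P - X)"
  proof (subst openin_subopen, intro ballI)
    fix \<xi> assume \<xi>: "\<xi> \<in> topspace P - X"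
    then have "\<And>C. \<xi> C \<in> Q C" unfolding topP by simp
    then have "C \<notin> con \<Longrightarrow> \<xi> C = {}" "C \<in> con \<Longrightarrow> \<exists>a\<in>L. \<xi> C = coset a C" for C
      unfolding Q_def by (metis singletonD, smt (verit) mem_Collect_eq)
    \<comment> \<open>Failure of compatibility is visible on two coordinates, hence persists in an
      open set.\<close>
    then obtain C D where CD: "C \<in> con" "D \<in> con" "C \<subseteq> D" "\<not> \<xi> C \<subseteq> \<xi> D"
      using \<xi> unfolding Lbar_def by blast
    let ?T = "{\<eta> \<in> topspace P. \<eta> C \<in> {\<xi> C}} \<inter> {\<eta> \<in> topspace P. \<eta> D \<in> {\<xi> D}}"
    have "openin P ?T" by (intro openin_Int open_basic)
    moreover have "\<xi> \<in> ?T" using \<xi> by simp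
    moreover have "?T \<subseteq> topspace P - X" using CD X_mono by fastforce
    ultimately show "\<exists>T. openin P T \<and> \<xi> \<in> T \<and> T \<subseteq> topspace P - X" by blast
  qed
  then have "closedin P X" using sub by (simp add: closedin_def)
  then have "compactin P X" using \<open>compact_space P\<close> by (simp add: closedin_compact_space)
  define V where "V x = {\<eta> \<in> topspace P. \<eta> (N x) \<in> {x (N x)}}" for x
  have "\<forall>U\<in>V ` X. openin P U" "X \<subseteq> \<Union> (V ` X)"
    unfolding V_def using open_basic sub by blast+
  then obtain \<F> where "finite \<F>" "\<F> \<subseteq> V ` X" "X \<subseteq> \<Union>\<F>"
    using \<open>compactin P X\<close> unfolding compactin_def by meson
  then obtain F where F: "finite F" "F \<subseteq> X" "X \<subseteq> \<Union> (V ` F)"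
    by (metis finite_subset_image)
  have "\<exists>x\<in>F. \<xi> (N x) = x (N x)" if "\<xi> \<in> X" for \<xi>
  proof -
    obtain x where "x \<in> F" "\<xi> \<in> V x" using F(3) \<open>\<xi> \<in> X\<close> by blast
    then show ?thesis unfolding V_def by blast
  qed
  then show ?thesis using F by blast
qed

text \<open>Replaces the closure defining \<open>ext_graph\<close> by coset arithmetic: at each
  level the two ends are approximated by an element of \<open>L\<close> and its image. The
  approximant may change with \<open>C\<close>.\<close>

lemma arrow_iff:
  "(y, g, x) \<in> arrows \<longleftrightarrow> snd g \<in> G \<and> x \<in> X \<and> y \<in> X \<and>
     (\<forall>C\<in>con. \<exists>l\<in>L. act g l \<in> L \<and> x C = coset l C \<and> y C = coset (act g l) C)"
proof -
  let ?P = "prod_topology (Lbar_top M L) (Lbar_top M L)"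
  let ?S = "{(lemb M L x, lemb M L (fst g + snd g * x)) | x. x \<in> pdom L g}"
  have "(x, y) \<in> ext_graph M L g \<longleftrightarrow> x \<in> X \<and> y \<in> X \<and>
     (\<forall>C\<in>con. \<exists>l\<in>L. act g l \<in> L \<and> x C = coset l C \<and> y C = coset (act g l) C)" (is "_ \<longleftrightarrow> ?r")
  proof
    assume "(x, y) \<in> ext_graph M L g"
    then have xy: "x \<in> X" "y \<in> X" and cl: "\<And>T. (x, y) \<in> T \<Longrightarrow> openin ?P T \<Longrightarrow> \<exists>z\<in>?S. z \<in> T"
      unfolding ext_graph_def in_closure_of by (auto simp: topspace_Lbar_top)
    have "\<exists>l\<in>L. act g l \<in> L \<and> x C = coset l C \<and> y C = coset (act g l) C" if "C \<in> con" for C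
    proof -
      have "openin ?P ({\<xi> \<in> X. \<xi> C = x C} \<times> {\<xi> \<in> X. \<xi> C = y C})"
        using openin_Lbar_basic[OF that] by (simp add: openin_prod_Times_iff)
      then have "\<exists>z\<in>?S. z \<in> {\<xi> \<in> X. \<xi> C = x C} \<times> {\<xi> \<in> X. \<xi> C = y C}"
        using xy by (intro cl) auto
      then show ?thesis using that by (auto simp: pdom_def act_def lemb_def)
    qed
    then show ?r using xy by blast
  next
    assume r: ?r
    have "\<exists>z\<in>?S. z \<in> T" if T: "(x, y) \<in> T" "openin ?P T" for T
    proof -
      obtain U V where U: "openin (Lbar_top M L) U" "x \<in> U" and V: "openin (Lbar_top M L) V" "y \<in> V"
        and UV: "U \<times> V \<subseteq> T"
        using T unfolding openin_prod_topology_alt by blast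
      obtain C where C: "C \<in> con" "\<forall>z\<in>X. z C = x C \<longrightarrow> z \<in> U" using Lbar_top_nbhd[OF U] by blast
      obtain D where D: "D \<in> con" "\<forall>z\<in>X. z D = y D \<longrightarrow> z \<in> V" using Lbar_top_nbhd[OF V] by blast
      obtain l where l: "l \<in> L" "act g l \<in> L" "x (C \<inter> D) = coset l (C \<inter> D)"
        "y (C \<inter> D) = coset (act g l) (C \<inter> D)"
        using r con_Int[OF C(1) D(1)] by blast
      have "x C = coset l C" "y D = coset (act g l) D"
        using X_coset_mono[OF _ con_Int[OF C(1) D(1)]] C(1) D(1) l(3,4) r by auto
      then have "lemb M L l \<in> U" "lemb M L (act g l) \<in> V"
        using C D l(1,2) lemb_X by (auto simp: lemb_def)
      then show ?thesis
        using UV l(1,2) by (intro bexI[of _ "(lemb M L l, lemb M L (act g l))"]) (auto simp: pdom_def act_def)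
    qed
    then show "(x, y) \<in> ext_graph M L g"
      using r unfolding ext_graph_def in_closure_of by (simp add: topspace_Lbar_top)
  qed
  moreover have "(y, g, x) \<in> arrows \<longleftrightarrow> snd g \<in> G \<and> (x, y) \<in> ext_graph M L g"
    unfolding gpd_arrows_def by (cases g) simp
  ultimately show ?thesis by simp
qed

lemma act_diff: "act g x - act g y = snd g * (x - y)"
  by (simp add: act_def algebra_simps)

text \<open>Approximants of the two sources differ by an element of \<open>C\<close>, their images
  by \<open>u\<close> times it, and \<open>G_con\<close> makes this small. The translation part
  cancels in the difference, so one \<open>C\<close> serves all \<open>b\<close> and all
  points.\<close>

lemma arrow_range_locally_determined:
  assumes "u \<in> G" "D \<in> con"
  shows "\<exists>C\<in>con. \<forall>b y x y' x'. (y, (b, u), x) \<in> arrows \<longrightarrow> (y', (b, u), x') \<in> arrows \<longrightarrow>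
           x' C = x C \<longrightarrow> y' D = y D"
proof -
  obtain C0 where C0: "C0 \<in> con" "\<forall>x\<in>C0. u * x \<in> D" using G_con[OF assms] by blast
  define C where "C = C0 \<inter> D"
  have C: "C \<in> con" "C \<subseteq> D" unfolding C_def using con_Int[OF C0(1) assms(2)] by auto
  have "y' D = y D" if a: "(y, (b, u), x) \<in> arrows" "(y', (b, u), x') \<in> arrows" "x' C = x C"
    for b y x y' x'
  proof -
    have X: "y \<in> X" "y' \<in> X" using a by (auto simp: arrow_iff)
    obtain l where l: "x C = coset l C" "y C = coset (act (b, u) l) C"
      using a(1) C(1) unfolding arrow_iff by blast
    obtain l' where l': "x' C = coset l' C" "y' C = coset (act (b, u) l') C"
      using a(2) C(1) unfolding arrow_iff by blast
    have "l' - l \<in> C" using l(1) l'(1) a(3) coset_eq_iff[OF con_subgroup[OF C(1)]] by metis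
    then have "act (b, u) l' - act (b, u) l \<in> D" using C0(2) by (auto simp: act_diff C_def)
    then show ?thesis
      using X_coset_mono[OF X(1) C(1) assms(2) C(2) l(2)] X_coset_mono[OF X(2) C(1) assms(2) C(2) l'(2)]
        coset_eq_iff[OF con_subgroup[OF assms(2)]] by metis
  qed
  then show ?thesis by (intro bexI[OF _ C(1)] allI impI)
qed

lemma arrows_subset: "arrows \<subseteq> X \<times> (UNIV \<times> G) \<times> X"
proof
  fix \<alpha> assume "\<alpha> \<in> arrows"
  then show "\<alpha> \<in> X \<times> (UNIV \<times> G) \<times> X"
    by (cases \<alpha>) (simp add: arrow_iff mem_Times_iff)
qed

lemma topspace_gpd_top: "topspace (gpd_top M L) = arrows"
  unfolding gpd_top_def using arrows_subset by (simp add: topspace_Lbar_top Int_absorb1)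

text \<open>The groupoid is etale: labels are discrete and the source is a local coordinate. The
  condition on the range is implied by one on the source through the preceding continuity
  statement.\<close>

lemma gpd_top_nbhd:
  assumes "openin (gpd_top M L) U" "(y, g, x) \<in> U"
  shows "\<exists>C\<in>con. \<forall>y' x'. (y', g, x') \<in> arrows \<longrightarrow> x' C = x C \<longrightarrow> (y', g, x') \<in> U"
proof -
  obtain T where T: "openin (prod_topology (Lbar_top M L)
        (prod_topology (discrete_topology (UNIV \<times> G)) (Lbar_top M L))) T" "U = T \<inter> arrows"
    using assms(1) unfolding gpd_top_def openin_subtopology by blast
  have a: "(y, g, x) \<in> arrows" using assms(2) T(2) by blast
  obtain V W where V: "openin (Lbar_top M L) V" "y \<in> V" "(g, x) \<in> W" "V \<times> W \<subseteq> T"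
     "openin (prod_topology (discrete_topology (UNIV \<times> G)) (Lbar_top M L)) W"
    using iffD1[OF openin_prod_topology_alt T(1), rule_format, of y "(g, x)"] assms(2) T(2) by auto
  obtain H Z where Z: "openin (Lbar_top M L) Z" "x \<in> Z" "g \<in> H" "H \<times> Z \<subseteq> W"
    using iffD1[OF openin_prod_topology_alt V(5), rule_format, OF V(3)] by blast
  obtain D where D: "D \<in> con" "\<forall>z\<in>X. z D = y D \<longrightarrow> z \<in> V" using Lbar_top_nbhd[OF V(1,2)] by blast
  obtain C where C: "C \<in> con" "\<forall>z\<in>X. z C = x C \<longrightarrow> z \<in> Z" using Lbar_top_nbhd[OF Z(1,2)] by blast
  have "snd g \<in> G" using a by (simp add: arrow_iff)
  then obtain E where E: "E \<in> con" "\<forall>b y x y' x'. (y, (b, snd g), x) \<in> arrows \<longrightarrow>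
      (y', (b, snd g), x') \<in> arrows \<longrightarrow> x' E = x E \<longrightarrow> y' D = y D"
    using arrow_range_locally_determined D(1) by meson
  have "(y', g, x') \<in> U" if a': "(y', g, x') \<in> arrows" "x' (C \<inter> E) = x (C \<inter> E)" for y' x'
  proof -
    have X: "x' \<in> X" "x \<in> X" "y' \<in> X" using a a' by (auto simp: arrow_iff)
    have "x' C = x C" "x' E = x E"
      using X_agree_mono[OF X(1,2) con_Int[OF C(1) E(1)] _ _ a'(2)] C(1) E(1) by auto
    moreover from this have "y' D = y D" using E(2) a a'(1) by (metis prod.collapse)
    ultimately have "y' \<in> V" "x' \<in> Z" using C(2) D(2) X by auto
    then have "(y', g, x') \<in> T" using V(4) Z(3,4) by blast
    then show ?thesis using T(2) a'(1) by simp
  qed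
  then show ?thesis using con_Int[OF C(1) E(1)] by blast
qed

lemma openin_gpd_label: "openin (gpd_top M L) {\<alpha> \<in> arrows. fst (snd \<alpha>) = g}"
proof -
  have "openin (prod_topology (Lbar_top M L)
        (prod_topology (discrete_topology (UNIV \<times> G)) (Lbar_top M L))) (X \<times> ({g} \<inter> UNIV \<times> G) \<times> X)"
    unfolding openin_prod_Times_iff using topspace_Lbar_top openin_topspace by (metis Int_lower2 openin_discrete_topology)
  moreover have "{\<alpha> \<in> arrows. fst (snd \<alpha>) = g} = (X \<times> ({g} \<inter> UNIV \<times> G) \<times> X) \<inter> arrows"
    using arrows_subset by fastforce
  ultimately show ?thesis unfolding gpd_top_def openin_subtopology by blast
qed

lemma openin_gpd_source:
  assumes "C \<in> con"
  shows "openin (gpd_top M L) {\<alpha> \<in> arrows. gsrc \<alpha> C = Y}"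
proof -
  have "openin (prod_topology (Lbar_top M L) (prod_topology (discrete_topology (UNIV \<times> G)) (Lbar_top M L)))
      (X \<times> (UNIV \<times> G) \<times> {\<xi> \<in> X. \<xi> C = Y})"
    unfolding openin_prod_Times_iff
    using topspace_Lbar_top openin_topspace openin_Lbar_basic[OF assms]
    by (metis openin_discrete_topology order_refl)
  moreover have "{\<alpha> \<in> arrows. gsrc \<alpha> C = Y} = (X \<times> (UNIV \<times> G) \<times> {\<xi> \<in> X. \<xi> C = Y}) \<inter> arrows"
    unfolding gsrc_def using arrows_subset by fastforce
  ultimately show ?thesis unfolding gpd_top_def openin_subtopology by blast
qed

section \<open>Arrows from translations, composition and isotropy\<close>

lemma arrow_X: "(y, g, x) \<in> arrows \<Longrightarrow> x \<in> X" "(y, g, x) \<in> arrows \<Longrightarrow> y \<in> X"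
  by (auto simp: arrow_iff)

lemma translate_arrow:
  assumes "x \<in> X" "b \<in> L"
  shows "(translate b x, (b, 1), x) \<in> arrows"
  unfolding arrow_iff
proof (intro conjI ballI)
  fix C assume "C \<in> con"
  then obtain l where "l \<in> L" "x C = coset l C" using X_coset[OF assms(1)] by metis
  then show "\<exists>l\<in>L. act (b, 1) l \<in> L \<and> x C = coset l C \<and> translate b x C = coset (act (b, 1) l) C"
    using add_subgroup_add[OF L_subgroup assms(2)]
    by (intro bexI[of _ l]) (auto simp: act_def translate_def coset_coset)
qed (use assms translate_X gen_group.one in auto)

lemma unit_arrow: "x \<in> X \<Longrightarrow> (x, (0, 1), x) \<in> arrows"
  using translate_arrow[of x 0] add_subgroup_zero[OF L_subgroup] by (simp add: translate_zero)

text \<open>The pointwise form of the relation between \<open>(b, u)\<close> and translations in the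
  semidirect product. Both translations must be by elements of \<open>L\<close> because the action
  is only partial.\<close>

lemma arrow_translate:
  assumes "(y, (b, u), x) \<in> arrows" "c \<in> L" "u * c \<in> L"
  shows "(translate (u * c) y, (b, u), translate c x) \<in> arrows"
  unfolding arrow_iff
proof (intro conjI ballI)
  fix C assume "C \<in> con"
  then obtain l where l: "l \<in> L" "act (b, u) l \<in> L" "x C = coset l C" "y C = coset (act (b, u) l) C"
    using assms(1) unfolding arrow_iff by blast
  have "act (b, u) (c + l) = u * c + act (b, u) l" by (simp add: act_def algebra_simps)
  then show "\<exists>l\<in>L. act (b, u) l \<in> L \<and> translate c x C = coset l C \<and>
      translate (u * c) y C = coset (act (b, u) l) C"
    using l add_subgroup_add[OF L_subgroup assms(2), of l] add_subgroup_add[OF L_subgroup assms(3) l(2)]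
    by (intro bexI[of _ "c + l"]) (auto simp: translate_def coset_coset)
qed (use assms translate_X in \<open>auto simp: arrow_iff\<close>)

lemma arrow_comp:
  assumes "(z, g, y) \<in> arrows" "(y, h, x) \<in> arrows"
  shows "(z, gdot g h, x) \<in> arrows"
  unfolding arrow_iff
proof (intro conjI ballI)
  show "snd (gdot g h) \<in> G" using assms by (auto simp: arrow_iff gdot_def intro: gen_group.mult)
  show "x \<in> X" "z \<in> X" using assms arrow_X by blast+
  fix D assume D: "D \<in> con"
  have "snd g \<in> G" using assms(1) by (simp add: arrow_iff)
  then obtain C0 where C0: "C0 \<in> con" "\<forall>e\<in>C0. snd g * e \<in> D" using G_con D by blast
  \<comment> \<open>The two arrows approximate \<open>y\<close> by elements that agree only modulo
    \<open>C\<close>; this choice lets the linear part of \<open>g\<close> carry the discrepancy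
    into \<open>D\<close>.\<close>
  define C where "C = C0 \<inter> D"
  have C: "C \<in> con" "C \<subseteq> D" unfolding C_def using con_Int[OF C0(1) D] by auto
  obtain l where l: "l \<in> L" "act h l \<in> L" "x C = coset l C" "y C = coset (act h l) C"
    using assms(2) C(1) unfolding arrow_iff by blast
  obtain l' where l': "l' \<in> L" "act g l' \<in> L" "y C = coset l' C" "z C = coset (act g l') C"
    using assms(1) C(1) unfolding arrow_iff by blast
  have "act h l - l' \<in> C" using l(4) l'(3) coset_eq_iff[OF con_subgroup[OF C(1)]] by metis
  then have d: "act g (act h l) - act g l' \<in> D" using C0(2) by (auto simp: act_diff C_def)
  \<comment> \<open>The composite must be defined at \<open>l\<close> itself, not only near it; this
    holds because the discrepancy lies in \<open>D\<close>, hence in \<open>L\<close>.\<close>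
  then have "act g l' + (act g (act h l) - act g l') \<in> L"
    using con_L[OF D] by (intro add_subgroup_add[OF L_subgroup l'(2)]) auto
  then have "act (gdot g h) l \<in> L" by (simp add: act_gdot)
  moreover have "x D = coset l D"
    using X_coset_mono[OF \<open>x \<in> X\<close> C(1) D C(2) l(3)] .
  moreover have "z D = coset (act (gdot g h) l) D"
    using X_coset_mono[OF \<open>z \<in> X\<close> C(1) D C(2) l'(4)] d coset_eq_iff[OF con_subgroup[OF D]]
    unfolding act_gdot by metis
  ultimately show "\<exists>l\<in>L. act (gdot g h) l \<in> L \<and> x D = coset l D \<and> z D = coset (act (gdot g h) l) D"
    using l(1) by blast
qed

lemma translation_arrow_range:
  assumes "(y, (b, 1), x) \<in> arrows"
  shows "y = translate b x"
proof (rule ext)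
  fix C
  show "y C = translate b x C"
  proof (cases "C \<in> con")
    case True
    then obtain l where "x C = coset l C" "y C = coset (act (b, 1) l) C"
      using assms unfolding arrow_iff by blast
    then show ?thesis by (simp add: translate_def coset_coset act_def)
  next
    case False
    then show ?thesis
      using X_outside arrow_X[OF assms] by (auto simp: translate_def coset_def)
  qed
qed

text \<open>The translation part is chosen so that the affine map fixes \<open>l\<close>. This
  realises every linear part at a point that can be placed in any prescribed coset.\<close>

lemma stabilizer_arrow:
  assumes "l \<in> L" "u \<in> G"
  shows "(lemb M L l, (l - u * l, u), lemb M L l) \<in> arrows"
  unfolding arrow_iff using assms lemb_X by (auto simp: act_def lemb_def intro!: bexI[of _ l])

text \<open>Pigeonhole: among the multiples of an element of \<open>R\<close> two share a coset
  representative of the span, so their difference lies in it.\<close>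

lemma multiple_in_span_M: "\<exists>n>0. of_nat n * (x::'a) \<in> zspan M"
proof -
  obtain F where F: "finite F" "F \<subseteq> R" "\<And>x. x \<in> R \<Longrightarrow> \<exists>f\<in>F. x - f \<in> zspan M"
    using M_span unfolding finite_index_def by blast
  obtain m where m: "m > 0" "of_nat m * x \<in> R" using clear_denominator by blast
  define r where "r = of_nat m * x"
  have "\<exists>f\<in>F. of_nat k * r - f \<in> zspan M" for k
    using F(3) add_subgroup_of_nat[OF add_subgroup_R] m(2) r_def by blast
  then obtain f where f: "\<And>k. f k \<in> F" "\<And>k::nat. of_nat k * r - f k \<in> zspan M" by metis
  have "\<not> inj f" using F(1) f(1) finite_subset[of "range f" F] finite_imageD[of f UNIV] by auto
  then obtain i j where "i \<noteq> j" "f i = f j" by (auto simp: inj_def)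
  then obtain i j where ij: "i < j" "f i = f j" by (metis linorder_neqE_nat)
  have "of_nat (j - i) * r = (of_nat j * r - f j) - (of_nat i * r - f i)"
    using ij by (simp add: of_nat_diff left_diff_distrib)
  also have "\<dots> \<in> zspan M" by (rule add_subgroup_diff[OF add_subgroup_zspan f(2) f(2)])
  finally have "of_nat ((j - i) * m) * x \<in> zspan M" by (simp only: r_def mult_of_nat_of_nat)
  then show ?thesis using ij(1) m(1) by (intro exI[of _ "(j - i) * m"]) auto
qed

text \<open>QR consists of rational combinations of group elements. Closure under division by
  positive integers takes the place of explicit coefficients.\<close>

lemma Q_span_G_induct:
  assumes "\<And>u. u \<in> G \<Longrightarrow> P u" "P 0" "\<And>x y. P x \<Longrightarrow> P y \<Longrightarrow> P (x + y)" "\<And>x. P x \<Longrightarrow> P (- x)"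
    and div: "\<And>n x. n > 0 \<Longrightarrow> P (of_nat n * x) \<Longrightarrow> P x"
  shows "P (x::'a)"
proof -
  have "zspan M \<subseteq> Collect P"
  proof (rule zspan_minimal)
    show "M \<subseteq> Collect P" using assms(1) gen_group.gen by blast
    show "add_subgroup (Collect P)" using assms(2-4) by (simp add: add_subgroup_def)
  qed
  then show ?thesis using multiple_in_span_M[of x] div by blast
qed

text \<open>The only use of semisimplicity.\<close>

lemma semiprime:
  assumes "\<And>r. z * r * z = 0"
  shows "z = (0::'a)"
proof -
  have "z \<in> I" if I: "maximal_left_ideal I" for I
  proof (rule ccontr)
    assume z: "z \<notin> I"
    have li: "left_ideal I" "I \<noteq> UNIV" and maxI: "\<And>J. left_ideal J \<Longrightarrow> I \<subseteq> J \<Longrightarrow> J \<noteq> UNIV \<Longrightarrow> J = I"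
      using I unfolding maximal_left_ideal_def by auto
    have sg: "add_subgroup I" and mI: "\<And>a x. x \<in> I \<Longrightarrow> a * x \<in> I"
      using li(1) unfolding left_ideal_def by auto
    define J where "J = {i + a * z | i a. i \<in> I}"
    have J: "i + a * z \<in> J" if "i \<in> I" for i a using that by (auto simp: J_def)
    have "left_ideal J"
      unfolding left_ideal_def add_subgroup_def
    proof (intro conjI ballI allI impI)
      show "0 \<in> J" using J[OF add_subgroup_zero[OF sg], of 0] by simp
      fix x y assume "x \<in> J" "y \<in> J"
      then obtain i a j b where e: "x = i + a * z" "y = j + b * z" "i \<in> I" "j \<in> I"
        unfolding J_def by blast
      show "x + y \<in> J" using J[OF add_subgroup_add[OF sg e(3,4)], of "a + b"] e
        by (simp add: algebra_simps)
      show "- x \<in> J" using J[OF add_subgroup_neg[OF sg e(3)], of "- a"] e by simp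
    next
      fix a x assume "x \<in> J"
      then obtain i b where e: "x = i + b * z" "i \<in> I" unfolding J_def by blast
      show "a * x \<in> J" using J[OF mI[OF e(2), of a], of "a * b"] e(1) by (simp add: algebra_simps)
    qed
    moreover have "I \<subseteq> J" using J[of _ 0] by auto
    moreover have "z \<in> J" using J[OF add_subgroup_zero[OF sg], of 1] by simp
    ultimately have "J = UNIV" using maxI z by blast
    then have "1 \<in> J" by simp
    then obtain i a where e: "1 = i + a * z" "i \<in> I" unfolding J_def by blast
    \<comment> \<open>Multiplying from the left by \<open>z\<close> kills the second summand and
      leaves an element of the left ideal \<open>I\<close>.\<close>
    have "z = z * (i + a * z)" using e(1) by simp
    also have "\<dots> = z * i + z * a * z" by (simp add: algebra_simps)
    also have "\<dots> = z * i" using assms by simp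
    finally show False using mI[OF e(2), of z] z by simp
  qed
  then have "z \<in> jacobson_radical" unfolding jacobson_radical_def by blast
  then show ?thesis unfolding semisimple by simp
qed

end

subsection \<open>Linearising a groupoid isomorphism\<close>

locale groupoid_iso = S1: algebraic_system R1 L1 M1 + S2: algebraic_system R2 L2 M2
  for R1 L1 M1 :: "'a::ring_1 set" and R2 L2 M2 :: "'b::ring_1 set" +
  fixes \<Phi>
  assumes homeo: "homeomorphic_map (gpd_top M1 L1) (gpd_top M2 L2) \<Phi>"
    and composable_iff: "\<And>\<alpha> \<beta>. \<alpha> \<in> gpd_arrows M1 L1 \<Longrightarrow> \<beta> \<in> gpd_arrows M1 L1 \<Longrightarrow>
        gsrc \<alpha> = grng \<beta> \<longleftrightarrow> gsrc (\<Phi> \<alpha>) = grng (\<Phi> \<beta>)"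
    and comp: "\<And>\<alpha> \<beta>. \<alpha> \<in> gpd_arrows M1 L1 \<Longrightarrow> \<beta> \<in> gpd_arrows M1 L1 \<Longrightarrow>
        gsrc \<alpha> = grng \<beta> \<Longrightarrow> \<Phi> (gmult \<alpha> \<beta>) = gmult (\<Phi> \<alpha>) (\<Phi> \<beta>)"
begin

text \<open>The isomorphism is taken apart into a cocycle on arrows, the induced map of unit spaces
  (read off from unit arrows), and the cocycle on translations, which are defined at every point of
  the completion when the translation vector lies in \<open>L1\<close>.\<close>

definition label where "label \<alpha> = fst (snd (\<Phi> \<alpha>))"
definition \<phi> where "\<phi> x = gsrc (\<Phi> (x, (0, 1), x))"
definition tlabel where "tlabel b x = label (translate b x, (b, 1), x)"

lemma \<Phi>_image: "\<Phi> ` S1.arrows = S2.arrows"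
  using homeomorphic_imp_surjective_map[OF homeo] S1.topspace_gpd_top S2.topspace_gpd_top by simp

lemma \<Phi>_inj: "inj_on \<Phi> S1.arrows"
  using homeomorphic_imp_injective_map[OF homeo] S1.topspace_gpd_top by simp

lemma \<Phi>_arrow: "\<alpha> \<in> S1.arrows \<Longrightarrow> \<Phi> \<alpha> \<in> S2.arrows"
  using \<Phi>_image by blast

text \<open>An arrow is composable with the unit arrows at its two ends. Since composability is
  preserved, the ends of the image arrow depend only on the ends of the arrow.\<close>

lemma \<Phi>_eq:
  assumes "(y, g, x) \<in> S1.arrows"
  shows "\<Phi> (y, g, x) = (\<phi> y, label (y, g, x), \<phi> x)"
proof -
  have u: "(x, (0, 1), x) \<in> S1.arrows" "(y, (0, 1), y) \<in> S1.arrows"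
    using assms S1.arrow_X S1.unit_arrow by blast+
  have "gsrc (\<Phi> (x, (0, 1), x)) = grng (\<Phi> (x, (0, 1), x))"
    using composable_iff[OF u(1,1)] by (simp add: gsrc_def grng_def)
  moreover have "gsrc (\<Phi> (y, g, x)) = grng (\<Phi> (x, (0, 1), x))"
    using composable_iff[OF assms u(1)] by (simp add: gsrc_def grng_def)
  moreover have "gsrc (\<Phi> (y, (0, 1), y)) = grng (\<Phi> (y, g, x))"
    using composable_iff[OF u(2) assms] by (simp add: gsrc_def grng_def)
  ultimately show ?thesis
    by (cases "\<Phi> (y, g, x)") (simp add: \<phi>_def label_def gsrc_def grng_def)
qed

lemma label_arrow:
  assumes "(y, g, x) \<in> S1.arrows"
  shows "(\<phi> y, label (y, g, x), \<phi> x) \<in> S2.arrows"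
  using \<Phi>_arrow[OF assms] unfolding \<Phi>_eq[OF assms] .

lemma \<phi>_X: "x \<in> S1.X \<Longrightarrow> \<phi> x \<in> S2.X"
  using label_arrow[OF S1.unit_arrow] S2.arrow_X by blast

lemma label_comp:
  assumes "(z, g, y) \<in> S1.arrows" "(y, h, x) \<in> S1.arrows"
  shows "label (z, gdot g h, x) = gdot (label (z, g, y)) (label (y, h, x))"
proof -
  have "\<Phi> (z, gdot g h, x) = gmult (\<Phi> (z, g, y)) (\<Phi> (y, h, x))"
    using comp[OF assms] by (simp add: gmult_eq gsrc_def grng_def)
  then show ?thesis
    unfolding \<Phi>_eq[OF assms(1)] \<Phi>_eq[OF assms(2)] gmult_eq by (simp add: label_def)
qed

text \<open>A unit arrow is idempotent, and a group has only one idempotent.\<close>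

lemma label_unit:
  assumes "x \<in> S1.X"
  shows "label (x, (0, 1), x) = (0, 1)"
proof -
  note u = S1.unit_arrow[OF assms]
  obtain b w where bw: "label (x, (0, 1), x) = (b, w)" by fastforce
  have w: "w \<in> S2.G" using label_arrow[OF u] by (simp add: bw S2.arrow_iff)
  have "gdot (b, w) (b, w) = (b, w)" using label_comp[OF u u] by (simp add: bw gdot_one)
  then have e: "b + w * b = b" "w * w = w * 1" by (auto simp: gdot_def)
  then have "w = 1" using S2.G_cancel[OF w] by blast
  then show ?thesis using e(1) bw by simp
qed

lemma \<phi>_inj: "x \<in> S1.X \<Longrightarrow> x' \<in> S1.X \<Longrightarrow> \<phi> x = \<phi> x' \<Longrightarrow> x = x'"
  using composable_iff[OF S1.unit_arrow S1.unit_arrow, of x x']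
  by (simp add: \<Phi>_eq S1.unit_arrow gsrc_def grng_def)

text \<open>Labels are discrete, so the arrows of the second groupoid with a given label form an
  open set; its preimage is a neighbourhood, which can be described by the source alone.\<close>

lemma label_locally_constant:
  assumes "(y, g, x) \<in> S1.arrows"
  shows "\<exists>C\<in>S1.con. \<forall>y' x'. (y', g, x') \<in> S1.arrows \<longrightarrow> x' C = x C \<longrightarrow>
           label (y', g, x') = label (y, g, x)"
proof -
  let ?U = "{\<beta> \<in> S2.arrows. fst (snd \<beta>) = label (y, g, x)}"
  have U: "openin (gpd_top M1 L1) {\<alpha> \<in> topspace (gpd_top M1 L1). \<Phi> \<alpha> \<in> ?U}"
    using homeomorphic_imp_continuous_map[OF homeo] S2.openin_gpd_label
    by (rule openin_continuous_map_preimage)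
  have "(y, g, x) \<in> {\<alpha> \<in> topspace (gpd_top M1 L1). \<Phi> \<alpha> \<in> ?U}"
    using assms \<Phi>_arrow S1.topspace_gpd_top by (simp add: label_def)
  from S1.gpd_top_nbhd[OF U this] show ?thesis
    unfolding mem_Collect_eq label_def by blast
qed

text \<open>Openness of the map of unit spaces, extracted from openness of \<Phi> near the unit
  arrow at \<open>x\<close>.\<close>

lemma \<phi>_nbhd:
  assumes x: "x \<in> S1.X" and C: "C \<in> S1.con"
  shows "\<exists>D\<in>S2.con. \<forall>\<eta>\<in>S2.X. \<eta> D = \<phi> x D \<longrightarrow> (\<exists>x'\<in>S1.X. \<phi> x' = \<eta> \<and> x' C = x C)"
proof -
  let ?U = "{\<alpha> \<in> S1.arrows. gsrc \<alpha> C = x C}"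
  have "openin (gpd_top M2 L2) (\<Phi> ` ?U)"
    using homeomorphic_imp_open_map[OF homeo] S1.openin_gpd_source[OF C] by (simp add: open_map_def)
  moreover have "(\<phi> x, (0, 1), \<phi> x) \<in> \<Phi> ` ?U"
    using S1.unit_arrow[OF x] \<Phi>_eq[OF S1.unit_arrow[OF x]] label_unit[OF x]
    by (intro rev_image_eqI[of "(x, (0, 1), x)"]) (auto simp: gsrc_def)
  ultimately obtain D where D: "D \<in> S2.con"
    "\<forall>y' x'. (y', (0, 1), x') \<in> S2.arrows \<longrightarrow> x' D = \<phi> x D \<longrightarrow> (y', (0, 1), x') \<in> \<Phi> ` ?U"
    using S2.gpd_top_nbhd by meson
  have "\<exists>x'\<in>S1.X. \<phi> x' = \<eta> \<and> x' C = x C" if "\<eta> \<in> S2.X" "\<eta> D = \<phi> x D" for \<eta>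
  proof -
    have "(\<eta>, (0, 1), \<eta>) \<in> \<Phi> ` ?U" using D(2) S2.unit_arrow[OF that(1)] that(2) by blast
    then obtain y' g x' where a: "(y', g, x') \<in> S1.arrows" "x' C = x C" "\<Phi> (y', g, x') = (\<eta>, (0, 1), \<eta>)"
      by (auto simp: gsrc_def)
    then show ?thesis using \<Phi>_eq[OF a(1)] S1.arrow_X[OF a(1)] by auto
  qed
  then show ?thesis using D(1) by blast
qed

section \<open>Uniform local constancy of translation labels\<close>

lemma tlabel_add:
  assumes "x \<in> S1.X" "a \<in> L1" "b \<in> L1"
  shows "tlabel (a + b) x = gdot (tlabel a (translate b x)) (tlabel b x)"
  using label_comp[OF S1.translate_arrow[OF S1.translate_X[OF assms(3,1)] assms(2)]
      S1.translate_arrow[OF assms(1,3)]]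
  by (simp add: tlabel_def gdot_def translate_translate)

lemma tlabel_zero: "x \<in> S1.X \<Longrightarrow> tlabel 0 x = (0, 1)"
  by (simp add: tlabel_def translate_zero label_unit)

lemma tlabel_uniform1:
  assumes b: "b \<in> L1"
  shows "\<exists>C\<in>S1.con. \<forall>x\<in>S1.X. \<forall>x'\<in>S1.X. x C = x' C \<longrightarrow> tlabel b x = tlabel b x'"
proof -
  have "\<exists>C\<in>S1.con. \<forall>x'\<in>S1.X. x' C = x C \<longrightarrow> tlabel b x' = tlabel b x" if "x \<in> S1.X" for x
  proof -
    obtain C where "C \<in> S1.con" "\<forall>y' x'. (y', (b, 1), x') \<in> S1.arrows \<longrightarrow> x' C = x C \<longrightarrow>
        label (y', (b, 1), x') = label (translate b x, (b, 1), x)"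
      using label_locally_constant[OF S1.translate_arrow[OF \<open>x \<in> S1.X\<close> b]] by blast
    then show ?thesis unfolding tlabel_def using S1.translate_arrow[OF _ b] by blast
  qed
  then obtain N where N: "\<And>x. x \<in> S1.X \<Longrightarrow> N x \<in> S1.con"
    "\<And>x x'. x \<in> S1.X \<Longrightarrow> x' \<in> S1.X \<Longrightarrow> x' (N x) = x (N x) \<Longrightarrow> tlabel b x' = tlabel b x"
    by metis
  have "\<exists>F. finite F \<and> F \<subseteq> S1.X \<and> (\<forall>\<xi>\<in>S1.X. \<exists>x\<in>F. \<xi> (N x) = x (N x))"
    by (rule S1.X_cover) (rule N(1))
  then obtain F where F: "finite F" "F \<subseteq> S1.X" "\<forall>\<xi>\<in>S1.X. \<exists>x\<in>F. \<xi> (N x) = x (N x)"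
    by (elim exE conjE) (rule that)
  have "N ` F \<subseteq> S1.con" using F(2) N(1) by blast
  then obtain C where C: "C \<in> S1.con" "\<forall>D\<in>N ` F. C \<subseteq> D"
    using S1.con_finite_Inter[of "N ` F"] F(1) by blast
  have "tlabel b x = tlabel b x'" if x: "x \<in> S1.X" "x' \<in> S1.X" "x C = x' C" for x x'
  proof -
    obtain z where z: "z \<in> F" "x (N z) = z (N z)" using F(3) x(1) by blast
    then have zX: "z \<in> S1.X" using F(2) by blast
    have "x (N z) = x' (N z)"
      using S1.X_agree_mono[OF x(1,2) C(1) N(1)[OF zX] _ x(3)] C(2) z(1) by blast
    then show ?thesis using N(2)[OF zX] x z(2) by metis
  qed
  then show ?thesis using C(1) by blast
qed

text \<open>Compactness gives a level \<open>C\<close> for one translation only. Intersecting the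
  levels of finitely many generators gives a common one, and the translations for which it works
  form a subgroup, because translating two points preserves their agreement at
  \<open>C\<close>.\<close>

lemma tlabel_uniform:
  "\<exists>C\<in>S1.con. \<exists>B. add_subgroup B \<and> S1.full B \<and> B \<subseteq> L1 \<and>
     (\<forall>b\<in>B. \<forall>x\<in>S1.X. \<forall>x'\<in>S1.X. x C = x' C \<longrightarrow> tlabel b x = tlabel b x')"
proof -
  obtain k where k: "k > 0" "\<forall>r\<in>R1. of_nat k * r \<in> L1"
    using S1.full_L unfolding S1.full_def by blast
  obtain T where T: "finite T" "T \<subseteq> R1" "R1 = zspan T" using S1.fg by (auto simp: fg_add_def)
  have "\<exists>C\<in>S1.con. \<forall>x\<in>S1.X. \<forall>x'\<in>S1.X. x C = x' C \<longrightarrow> tlabel (of_nat k * t) x = tlabel (of_nat k * t) x'"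
    if "t \<in> T" for t
    using tlabel_uniform1[of "of_nat k * t"] k(2) T(2) that by blast
  then obtain N where N: "\<And>t. t \<in> T \<Longrightarrow> N t \<in> S1.con"
    "\<And>t x x'. t \<in> T \<Longrightarrow> x \<in> S1.X \<Longrightarrow> x' \<in> S1.X \<Longrightarrow> x (N t) = x' (N t) \<Longrightarrow>
        tlabel (of_nat k * t) x = tlabel (of_nat k * t) x'"
    by metis
  have "N ` T \<subseteq> S1.con" using N(1) by blast
  then obtain C where C: "C \<in> S1.con" "\<forall>D\<in>N ` T. C \<subseteq> D"
    using S1.con_finite_Inter[of "N ` T"] T(1) by blast
  define B where "B = {b \<in> L1. \<forall>x\<in>S1.X. \<forall>x'\<in>S1.X. x C = x' C \<longrightarrow> tlabel b x = tlabel b x'}"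
  have BL: "b \<in> L1" if "b \<in> B" for b using that by (simp add: B_def)
  have BD: "tlabel b x = tlabel b x'" if "b \<in> B" "x \<in> S1.X" "x' \<in> S1.X" "x C = x' C" for b x x'
    using that unfolding B_def by blast
  have BI: "b \<in> B" if "b \<in> L1"
    "\<And>x x'. x \<in> S1.X \<Longrightarrow> x' \<in> S1.X \<Longrightarrow> x C = x' C \<Longrightarrow> tlabel b x = tlabel b x'" for b
    unfolding B_def using that by blast
  have TB: "of_nat k * t \<in> B" if t: "t \<in> T" for t
  proof -
    have "tlabel (of_nat k * t) x = tlabel (of_nat k * t) x'"
      if x: "x \<in> S1.X" "x' \<in> S1.X" "x C = x' C" for x x'
    proof (rule N(2)[OF t x(1,2)])
      show "x (N t) = x' (N t)"
        using C(2) t by (intro S1.X_agree_mono[OF x(1,2) C(1) N(1)[OF t] _ x(3)]) blast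
    qed
    moreover have "of_nat k * t \<in> L1" using k(2) T(2) t by blast
    ultimately show ?thesis by (intro BI)
  qed
  have tr: "translate b x C = translate b x' C" if "x C = x' C" for b x x'
    using that by (simp add: translate_def)
  have B: "add_subgroup B"
    unfolding add_subgroup_def
  proof (intro conjI ballI)
    show "0 \<in> B"
      by (rule BI[OF add_subgroup_zero[OF S1.L_subgroup]]) (simp only: tlabel_zero)
    fix a b assume ab: "a \<in> B" "b \<in> B"
    note L = BL[OF ab(1)] BL[OF ab(2)]
    have "tlabel (a + b) x = tlabel (a + b) x'" if x: "x \<in> S1.X" "x' \<in> S1.X" "x C = x' C" for x x'
      using BD[OF ab(1) S1.translate_X[OF L(2) x(1)] S1.translate_X[OF L(2) x(2)]
          tr[of x x' b, OF x(3)]]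
        BD[OF ab(2) x] tlabel_add[OF x(1) L] tlabel_add[OF x(2) L] by simp
    then show "a + b \<in> B" by (rule BI[OF add_subgroup_add[OF S1.L_subgroup L]])
    have nL: "- a \<in> L1" using add_subgroup_neg[OF S1.L_subgroup L(1)] .
    have "tlabel (- a) x = tlabel (- a) x'" if x: "x \<in> S1.X" "x' \<in> S1.X" "x C = x' C" for x x'
    proof -
      define z z' where "z = translate (- a) x" and "z' = translate (- a) x'"
      have z: "z \<in> S1.X" "z' \<in> S1.X" "z C = z' C"
        using S1.translate_X[OF nL] x(1,2) tr[of x x' "- a", OF x(3)] by (simp_all add: z_def z'_def)
      have 1: "gdot (tlabel a z) (tlabel (- a) x) = (0, 1)"
        using tlabel_add[OF x(1) L(1) nL] tlabel_zero[OF x(1)] by (simp add: z_def)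
      have 2: "gdot (tlabel (- a) x') (tlabel a z') = (0, 1)"
        using tlabel_add[OF z(2) nL L(1)] tlabel_zero[OF z(2)]
        by (simp add: z'_def translate_translate translate_zero)
      \<comment> \<open>\<open>tlabel (- a) x\<close> is a right inverse and
        \<open>tlabel (- a) x'\<close> a left inverse of the common value of \<open>tlabel a\<close>
        at \<open>z\<close> and \<open>z'\<close>, so the two coincide.\<close>
      have "tlabel (- a) x' = gdot (tlabel (- a) x') (gdot (tlabel a z) (tlabel (- a) x))"
        by (simp add: 1 gdot_one)
      also have "\<dots> = tlabel (- a) x"
        using 2 BD[OF ab(1) z] by (simp add: gdot_assoc[symmetric] gdot_one)
      finally show ?thesis by simp
    qed
    then show "- a \<in> B" by (rule BI[OF nL])
  qed
  have "add_subgroup {r. of_nat k * r \<in> B}"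
    using B by (auto simp: add_subgroup_def distrib_left)
  then have "R1 \<subseteq> {r. of_nat k * r \<in> B}"
    unfolding T(3) using TB by (intro zspan_minimal) auto
  then have "S1.full B" unfolding S1.full_def using k(1) by blast
  then show ?thesis using B C(1) BL BD by blast
qed

text \<open>\<open>T\<close> lies inside \<open>C\<close> so that translations from \<open>T\<close>
  keep a point in the neighbourhood of \<open>x0\<close> where labels are constant; there the
  cocycle identity becomes a homomorphism identity.\<close>

definition linearizes where
  "linearizes x0 C T h \<longleftrightarrow> C \<in> S1.con \<and> add_subgroup T \<and> S1.full T \<and> T \<subseteq> C \<and>
     (\<forall>c\<in>T. \<forall>x\<in>S1.X. x C = x0 C \<longrightarrow> tlabel c x = h c) \<and>
     (\<forall>c\<in>T. \<forall>c'\<in>T. h (c + c') = gdot (h c) (h c'))"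

lemma linearizes_exists:
  assumes x0: "x0 \<in> S1.X"
  shows "\<exists>C T h. linearizes x0 C T h"
proof -
  obtain C B where C: "C \<in> S1.con" and B: "add_subgroup B" "S1.full B" "B \<subseteq> L1"
    and const: "\<forall>b\<in>B. \<forall>x\<in>S1.X. \<forall>x'\<in>S1.X. x C = x' C \<longrightarrow> tlabel b x = tlabel b x'"
    using tlabel_uniform by blast
  define h where "h c = tlabel c x0" for c
  have h: "tlabel c x = h c" if "c \<in> C \<inter> B" "x \<in> S1.X" "x C = x0 C" for c x
    using const that x0 unfolding h_def by blast
  have "h (c + c') = gdot (h c) (h c')" if c: "c \<in> C \<inter> B" "c' \<in> C \<inter> B" for c c'
  proof -
    have L: "c \<in> L1" "c' \<in> L1" using c B(3) by auto
    have "tlabel c (translate c' x0) = h c"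
      using h[OF c(1) S1.translate_X[OF L(2) x0]] S1.translate_agree[OF C _ x0] c(2) by simp
    then show ?thesis using tlabel_add[OF x0 L] by (simp add: h_def)
  qed
  then have "linearizes x0 C (C \<inter> B) h"
    unfolding linearizes_def
    using C h add_subgroup_Int[OF S1.con_subgroup[OF C] B(1)] S1.full_Int[OF S1.con_full[OF C] B(2)]
    by blast
  then show ?thesis by blast
qed

text \<open>Conjugation of \<open>h\<close> by \<gamma>, written without inverses. It is asked only
  on a full subset because \<open>u\<close> carries \<open>T\<close> to a merely commensurable group
  and labels are constant only near the source.\<close>

definition conjugates where
  "conjugates T h \<gamma> u \<longleftrightarrow> (\<exists>T'. S1.full T' \<and> T' \<subseteq> T \<and>
     (\<forall>c\<in>T'. u * c \<in> T \<and> gdot (h (u * c)) \<gamma> = gdot \<gamma> (h c)))"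

section \<open>Conjugating the local homomorphism by arrows\<close>

context
  fixes x0 C T h
  assumes lin: "linearizes x0 C T h" and x0: "x0 \<in> S1.X"
begin

lemma C_con: "C \<in> S1.con" and T_subgroup: "add_subgroup T" and T_full: "S1.full T"
  and T_L: "T \<subseteq> L1"
  and tlabel_h: "c \<in> T \<Longrightarrow> x \<in> S1.X \<Longrightarrow> x C = x0 C \<Longrightarrow> tlabel c x = h c"
  and h_add: "c \<in> T \<Longrightarrow> c' \<in> T \<Longrightarrow> h (c + c') = gdot (h c) (h c')"
  using lin S1.con_L unfolding linearizes_def by auto

lemma h_zero: "h 0 = (0, 1)"
  using tlabel_h[OF add_subgroup_zero[OF T_subgroup] x0] tlabel_zero[OF x0] by simp

text \<open>A translation with trivial label has the same image as the unit arrow at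
  \<open>x0\<close>, and \<Phi> is injective on arrows.\<close>

lemma h_inj:
  assumes c: "c \<in> T" and h: "h c = (0, 1)"
  shows "c = 0"
proof -
  have a: "(translate c x0, (c, 1), x0) \<in> S1.arrows" using S1.translate_arrow[OF x0] c T_L by blast
  have l: "label (translate c x0, (c, 1), x0) = (0, 1)"
    using tlabel_h[OF c x0] h by (simp add: tlabel_def)
  have "(\<phi> (translate c x0), (0, 1), \<phi> x0) \<in> S2.arrows" using label_arrow[OF a] l by simp
  then have "\<phi> (translate c x0) = \<phi> x0"
    using S2.translation_arrow_range by (fastforce simp: translate_zero)
  then have "\<Phi> (translate c x0, (c, 1), x0) = \<Phi> (x0, (0, 1), x0)"
    using \<Phi>_eq[OF a] l \<Phi>_eq[OF S1.unit_arrow[OF x0]] label_unit[OF x0] by simp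
  then show ?thesis using inj_onD[OF \<Phi>_inj _ a S1.unit_arrow[OF x0]] by blast
qed

text \<open>The label is unchanged when both ends of the arrow are translated by a small amount, and
  translating before or after the arrow computes the same composite.\<close>

lemma arrow_conjugates:
  assumes a: "(y, (b, u), x) \<in> S1.arrows" and x: "x C = x0 C" and y: "y C = x0 C"
  shows "conjugates T h (label (y, (b, u), x)) u"
proof -
  define \<gamma> where "\<gamma> = label (y, (b, u), x)"
  obtain C1 where C1: "C1 \<in> S1.con" "\<forall>y' x'. (y', (b, u), x') \<in> S1.arrows \<longrightarrow> x' C1 = x C1 \<longrightarrow>
      label (y', (b, u), x') = \<gamma>"
    using label_locally_constant[OF a] unfolding \<gamma>_def by blast
  define T' where "T' = (T \<inter> C1) \<inter> {c. u * c \<in> T}"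
  have "S1.full T'"
    unfolding T'_def using T_full S1.con_full[OF C1(1)] by (intro S1.full_Int S1.full_preimage)
  moreover have "u * c \<in> T \<and> gdot (h (u * c)) \<gamma> = gdot \<gamma> (h c)" if c: "c \<in> T'" for c
  proof -
    have cT: "c \<in> T" "c \<in> C1" "u * c \<in> T" using c by (auto simp: T'_def)
    then have cL: "c \<in> L1" "u * c \<in> L1" using T_L by auto
    note X = S1.arrow_X[OF a]
    let ?x = "translate c x" and ?y = "translate (u * c) y"
    have a': "(?y, (b, u), ?x) \<in> S1.arrows" using S1.arrow_translate[OF a cL] .
    have "label (?y, (b, u), ?x) = \<gamma>"
      using C1(2) a' S1.translate_agree[OF C1(1) cT(2) X(1)] by blast
    then have "label (?y, gdot (b, u) (c, 1), x) = gdot \<gamma> (h c)"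
      using label_comp[OF a' S1.translate_arrow[OF X(1) cL(1)]] tlabel_h[OF cT(1) X(1) x]
      by (simp add: tlabel_def)
    moreover have "label (?y, gdot (u * c, 1) (b, u), x) = gdot (h (u * c)) \<gamma>"
      using label_comp[OF S1.translate_arrow[OF X(2) cL(2)] a] tlabel_h[OF cT(3) X(2) y]
      by (simp add: tlabel_def \<gamma>_def)
    moreover have "gdot (u * c, 1) (b, u) = gdot (b, u) (c, 1)" by (simp add: gdot_def)
    ultimately show ?thesis using cT(3) by simp
  qed
  moreover have "T' \<subseteq> T" unfolding T'_def by blast
  ultimately show ?thesis unfolding \<gamma>_def[symmetric] conjugates_def by blast
qed

lemma G1_conjugates:
  assumes u: "u \<in> S1.G"
  shows "\<exists>b. \<exists>w\<in>S2.G. conjugates T h (b, w) u"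
proof -
  obtain l where l: "l \<in> L1" "x0 C = coset l C" using S1.X_coset[OF x0 C_con] .
  note a = S1.stabilizer_arrow[OF l(1) u]
  have near: "lemb M1 L1 l C = x0 C" using l C_con by (simp add: lemb_def)
  obtain b w where bw: "label (lemb M1 L1 l, (l - u * l, u), lemb M1 L1 l) = (b, w)" by fastforce
  have "w \<in> S2.G" using label_arrow[OF a] by (simp add: bw S2.arrow_iff)
  then show ?thesis using arrow_conjugates[OF a near near] unfolding bw by blast
qed

text \<open>Lifts arrows of the second groupoid: openness and injectivity of the map of unit spaces
  show that an arrow with both ends near the image of \<open>x0\<close> comes from one with both
  ends near \<open>x0\<close>.\<close>

lemma near_image:
  "\<exists>D\<in>S2.con. \<forall>y \<gamma> x. (y, \<gamma>, x) \<in> S2.arrows \<longrightarrow> y D = \<phi> x0 D \<longrightarrow> x D = \<phi> x0 D \<longrightarrow>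
      (\<exists>u\<in>S1.G. conjugates T h \<gamma> u)"
proof -
  obtain D where D: "D \<in> S2.con"
    "\<forall>\<eta>\<in>S2.X. \<eta> D = \<phi> x0 D \<longrightarrow> (\<exists>x'\<in>S1.X. \<phi> x' = \<eta> \<and> x' C = x0 C)"
    using \<phi>_nbhd[OF x0 C_con] by blast
  have "\<exists>u\<in>S1.G. conjugates T h \<gamma> u"
    if a: "(y, \<gamma>, x) \<in> S2.arrows" "y D = \<phi> x0 D" "x D = \<phi> x0 D" for y \<gamma> x
  proof -
    have "(y, \<gamma>, x) \<in> \<Phi> ` S1.arrows" using a(1) \<Phi>_image by simp
    then obtain y' b u x' where a': "(y', (b, u), x') \<in> S1.arrows" "\<Phi> (y', (b, u), x') = (y, \<gamma>, x)"
      by auto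
    have e: "\<phi> y' = y" "label (y', (b, u), x') = \<gamma>" "\<phi> x' = x" using \<Phi>_eq[OF a'(1)] a'(2) by auto
    have near: "y' C = x0 C" "x' C = x0 C"
      using D(2) a S2.arrow_X[OF a(1)] e \<phi>_inj S1.arrow_X[OF a'(1)] by metis+
    have "u \<in> S1.G" using a'(1) by (simp add: S1.arrow_iff)
    then show ?thesis
      using arrow_conjugates[OF a'(1) near(2,1)] unfolding e(2) by blast
  qed
  then show ?thesis using D(1) by blast
qed

lemma G2_conjugates:
  assumes w: "w \<in> S2.G"
  shows "\<exists>b. \<exists>u\<in>S1.G. conjugates T h (b, w) u"
proof -
  obtain D where D: "D \<in> S2.con"
    "\<And>y \<gamma> x. (y, \<gamma>, x) \<in> S2.arrows \<Longrightarrow> y D = \<phi> x0 D \<Longrightarrow> x D = \<phi> x0 D \<Longrightarrow>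
      \<exists>u\<in>S1.G. conjugates T h \<gamma> u"
    using near_image by blast
  obtain l where l: "l \<in> L2" "\<phi> x0 D = coset l D" using S2.X_coset[OF \<phi>_X[OF x0] D(1)] .
  have near: "lemb M2 L2 l D = \<phi> x0 D" using l D(1) by (simp add: lemb_def)
  show ?thesis using D(2)[OF S2.stabilizer_arrow[OF l(1) w] near near] by blast
qed

text \<open>Conjugating by a small translation \<open>d\<close> sends \<open>h c\<close> to
  \<open>h (u * c)\<close>. The quotient \<open>h e\<close> with \<open>e = u * c - c\<close> is
  thus a commutator with a translation, namely translation by \<open>(1 - snd (h c)) * d\<close>. As
  \<open>T\<close> is abelian, \<open>h e\<close> commutes with \<open>h c'\<close>, so
  \<open>snd (h c')\<close> fixes that vector.\<close>

lemma linear_part_unipotent: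
  "\<exists>S0. S1.full S0 \<and> S0 \<subseteq> T \<and> (\<forall>c\<in>S0. \<forall>c'\<in>T. (1 - snd (h c')) * (1 - snd (h c)) = 0)"
proof -
  obtain D where D: "D \<in> S2.con"
    "\<And>y \<gamma> x. (y, \<gamma>, x) \<in> S2.arrows \<Longrightarrow> y D = \<phi> x0 D \<Longrightarrow> x D = \<phi> x0 D \<Longrightarrow>
      \<exists>u\<in>S1.G. conjugates T h \<gamma> u"
    using near_image by blast
  \<comment> \<open>Taking a multiple of 1 makes \<open>d\<close> cancellable, so that the final
    identity concerns \<open>1 - snd (h c)\<close> itself.\<close>
  obtain m where m: "m > 0" "of_nat m * 1 \<in> D" using S2.full_multiple[OF S2.con_full[OF D(1)]] by blast
  define d where "d = (of_nat m :: 'b)"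
  have d: "d \<in> D" "d \<in> L2" using m(2) S2.con_L[OF D(1)] by (auto simp: d_def)
  obtain u where "conjugates T h (d, 1) u"
    using D(2)[OF S2.translate_arrow[OF \<phi>_X[OF x0] d(2)] S2.translate_agree[OF D(1) d(1) \<phi>_X[OF x0]] refl]
    by blast
  then obtain T' where T': "S1.full T'" "T' \<subseteq> T" "\<And>c. c \<in> T' \<Longrightarrow> u * c \<in> T"
    "\<And>c. c \<in> T' \<Longrightarrow> gdot (h (u * c)) (d, 1) = gdot (d, 1) (h c)"
    unfolding conjugates_def by blast
  have "(1 - snd (h c')) * (1 - snd (h c)) = 0" if c: "c \<in> T'" and c': "c' \<in> T" for c c'
  proof -
    have cT: "c \<in> T" "u * c \<in> T" using c T' by auto
    have nc: "- c \<in> T" using add_subgroup_neg[OF T_subgroup cT(1)] .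
    define e where "e = u * c - c"
    have e: "e \<in> T" using add_subgroup_diff[OF T_subgroup cT(2,1)] by (simp add: e_def)
    have uc: "h (u * c) = gdot (h e) (h c)" using h_add[OF e cT(1)] by (simp add: e_def)
    have "gdot (h (u * c)) (d, 1) = gdot (d, 1) (h c)" using T'(4) c by blast
    then have v: "snd (h (u * c)) = snd (h c)"
      and \<beta>: "fst (h (u * c)) + snd (h (u * c)) * d = d + fst (h c)"
      by (auto simp: gdot_def)
    have inv: "snd (h c) * snd (h (- c)) = 1"
      using h_add[OF cT(1) nc] h_zero by (simp add: gdot_def)
    have "snd (h e) * snd (h c) = snd (h c)" using uc v by (simp add: gdot_def)
    then have "snd (h e) * (snd (h c) * snd (h (- c))) = snd (h c) * snd (h (- c))"
      by (simp add: mult.assoc[symmetric])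
    then have ve: "snd (h e) = 1" using inv by simp
    have "fst (h (u * c)) = fst (h e) + fst (h c)" using uc ve by (simp add: gdot_def)
    then have be: "fst (h e) = (1 - snd (h c)) * d"
      using \<beta> v by (simp add: algebra_simps)
    have "gdot (h e) (h c') = gdot (h c') (h e)"
      using h_add[OF e c'] h_add[OF c' e] by (simp add: add.commute)
    then have "fst (h e) + fst (h c') = fst (h c') + snd (h c') * fst (h e)"
      using ve by (simp add: gdot_def)
    then have "(1 - snd (h c')) * fst (h e) = 0" by (simp add: algebra_simps)
    then have "(1 - snd (h c')) * (1 - snd (h c)) * of_nat m = 0"
      unfolding be d_def by (simp only: mult.assoc)
    then have "of_nat m * ((1 - snd (h c')) * (1 - snd (h c))) = of_nat m * 0"
      by (simp only: mult_of_nat_commute[of m] mult_zero_left)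
    then show ?thesis by (rule S2.of_nat_cancel[OF m(1)])
  qed
  then show ?thesis using T'(1,2) by blast
qed

text \<open>For \<open>v = 1 - z\<close> with \<open>z * z = 0\<close> one has
  \<open>v ^ n = 1 - of_nat n * z\<close>. Passing to a multiple of \<open>c\<close> therefore only
  produces an integer factor that can be cancelled.\<close>

lemma linear_part_multiple:
  assumes c: "c \<in> T" and sq: "(1 - snd (h c)) * (1 - snd (h c)) = 0"
  shows "1 - snd (h (of_nat n * c)) = of_nat n * (1 - snd (h c))"
proof (induction n)
  case 0
  then show ?case by (simp add: h_zero)
next
  case (Suc n)
  define v where "v = snd (h c)"
  have "h (of_nat (Suc n) * c) = gdot (h c) (h (of_nat n * c))"
    using h_add[OF c add_subgroup_of_nat[OF T_subgroup c, of n]] by (simp add: distrib_right)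
  then have "snd (h (of_nat (Suc n) * c)) = v * snd (h (of_nat n * c))" by (simp add: gdot_def v_def)
  moreover have "snd (h (of_nat n * c)) = 1 - of_nat n * (1 - v)"
    using Suc.IH by (simp add: v_def algebra_simps)
  ultimately have 1: "1 - snd (h (of_nat (Suc n) * c)) = 1 - v * (1 - of_nat n * (1 - v))" by simp
  have "v * (of_nat n * (1 - v)) = of_nat n * (v * (1 - v))" by (rule mult_of_nat_left_commute)
  also have "v * (1 - v) = 1 - v" using sq by (simp add: v_def algebra_simps)
  finally have "1 - v * (1 - of_nat n * (1 - v)) = 1 - v + of_nat n * (1 - v)"
    by (simp add: right_diff_distrib)
  also have "\<dots> = of_nat (Suc n) * (1 - v)" by (simp add: distrib_right)
  finally show ?case using 1 by (simp add: v_def)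
qed

text \<open>Conjugation by an element with linear part \<open>w\<close> moves \<open>w\<close> past
  the defect \<open>1 - snd (h _)\<close>, at the cost of replacing its argument by a point of
  \<open>S0\<close>; there \<open>z\<close> annihilates the defect from the left. So
  \<open>z * w * z = 0\<close> for group elements, then for their rational combinations.\<close>

lemma linear_part_trivial:
  "\<exists>S0. S1.full S0 \<and> S0 \<subseteq> T \<and> (\<forall>c\<in>S0. snd (h c) = 1)"
proof -
  obtain S0 where S0: "S1.full S0" "S0 \<subseteq> T"
    "\<And>c c'. c \<in> S0 \<Longrightarrow> c' \<in> T \<Longrightarrow> (1 - snd (h c')) * (1 - snd (h c)) = 0"
    using linear_part_unipotent by blast
  have "snd (h c) = 1" if c: "c \<in> S0" for c
  proof -
    define z where "z = 1 - snd (h c)"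
    have cT: "c \<in> T" using c S0(2) by blast
    have "z * w * z = 0" if w: "w \<in> S2.G" for w
    proof -
      obtain b u where "conjugates T h (b, w) u" using G2_conjugates[OF w] by blast
      then obtain T' where T': "S1.full T'" "\<And>c. c \<in> T' \<Longrightarrow> gdot (h (u * c)) (b, w) = gdot (b, w) (h c)"
        unfolding conjugates_def by blast
      have "S1.full (T' \<inter> {c. u * c \<in> S0})"
        by (intro S1.full_Int S1.full_preimage T'(1) S0(1))
      \<comment> \<open>The conjugation relation need not hold at \<open>c\<close> itself; a
        multiple lies in its domain and is mapped by \<open>u\<close> into
        \<open>S0\<close>.\<close>
      then obtain n where n: "n > 0" "of_nat n * c \<in> T'" "u * (of_nat n * c) \<in> S0"
        using S1.full_multiple[of _ c] by blast
      have "snd (h (u * (of_nat n * c))) * w = w * snd (h (of_nat n * c))"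
        using T'(2)[OF n(2)] by (simp add: gdot_def)
      then have "w * (1 - snd (h (of_nat n * c))) = (1 - snd (h (u * (of_nat n * c)))) * w"
        by (simp add: algebra_simps)
      then have "z * (w * (1 - snd (h (of_nat n * c)))) = z * (1 - snd (h (u * (of_nat n * c)))) * w"
        by (simp only: mult.assoc)
      also have "\<dots> = 0" using S0(3)[OF n(3) cT] by (simp add: z_def)
      finally have "z * (w * (of_nat n * z)) = 0"
        using linear_part_multiple[OF cT S0(3)[OF c cT]] by (simp add: z_def)
      then have "of_nat n * (z * w * z) = of_nat n * 0"
        by (simp add: mult_of_nat_left_commute[of w] mult_of_nat_left_commute[of z] mult.assoc)
      then show ?thesis by (rule S2.of_nat_cancel[OF n(1)])
    qed
    then have "z * r * z = 0" for r
    proof (rule S2.Q_span_G_induct)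
      fix n x assume n: "n > (0::nat)" and "z * (of_nat n * x) * z = 0"
      then have "of_nat n * (z * x * z) = of_nat n * 0"
        by (simp add: mult_of_nat_left_commute[of z] mult.assoc)
      then show "z * x * z = 0" by (rule S2.of_nat_cancel[OF n])
    qed (simp_all add: algebra_simps)
    then have "z = 0" by (rule S2.semiprime)
    then show ?thesis by (simp add: z_def)
  qed
  then show ?thesis using S0 by blast
qed

end

subsection \<open>The isomorphism of algebras\<close>

text \<open>What is left of \<open>conjugates\<close> once labels are pure translations: these
  commute, so only the linear part \<open>w\<close> of the conjugating element acts.\<close>

definition intertwines where
  "intertwines T \<beta> u w \<longleftrightarrow> (\<exists>T'. S1.full T' \<and> T' \<subseteq> T \<and> (\<forall>c\<in>T'. u * c \<in> T \<and> w * \<beta> c = \<beta> (u * c)))"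

lemma intertwines_if_conjugates:
  assumes "conjugates T h (b, w) u" and full: "S1.full {c \<in> T. snd (h c) = 1}"
  shows "intertwines {c \<in> T. snd (h c) = 1} (\<lambda>c. fst (h c)) u w"
proof -
  let ?T = "{c \<in> T. snd (h c) = 1}"
  obtain T' where T': "S1.full T'" "T' \<subseteq> T"
    "\<And>c. c \<in> T' \<Longrightarrow> gdot (h (u * c)) (b, w) = gdot (b, w) (h c)"
    using assms(1) unfolding conjugates_def by blast
  let ?T' = "T' \<inter> ?T \<inter> {c. u * c \<in> ?T}"
  have "S1.full ?T'" using T'(1) full by (intro S1.full_Int S1.full_preimage)
  moreover have "u * c \<in> ?T \<and> w * fst (h c) = fst (h (u * c))" if "c \<in> ?T'" for c
    using that T'(3)[of c] by (auto simp: gdot_def)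
  ultimately show ?thesis unfolding intertwines_def by blast
qed

lemma additive_linearization:
  assumes x0: "x0 \<in> S1.X"
  obtains T \<beta> where "add_subgroup T" "S1.full T" "T \<subseteq> L1"
    "\<And>c. c \<in> T \<Longrightarrow> tlabel c x0 = (\<beta> c, 1)"
    "\<And>c c'. c \<in> T \<Longrightarrow> c' \<in> T \<Longrightarrow> \<beta> (c + c') = \<beta> c + \<beta> c'"
    "\<And>c. c \<in> T \<Longrightarrow> \<beta> c = 0 \<Longrightarrow> c = 0"
    "\<And>u. u \<in> S1.G \<Longrightarrow> \<exists>w\<in>S2.G. intertwines T \<beta> u w"
    "\<And>w. w \<in> S2.G \<Longrightarrow> \<exists>u\<in>S1.G. intertwines T \<beta> u w"
proof -
  obtain C T h where lin: "linearizes x0 C T h" using linearizes_exists[OF x0] by blast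
  note T = T_subgroup[OF lin x0] and hadd = h_add[OF lin x0]
  \<comment> \<open>The set given by \<open>linear_part_trivial\<close> is only known to be full.
    The kernel of the linear part contains it and is a subgroup.\<close>
  define T1 where "T1 = {c \<in> T. snd (h c) = 1}"
  define \<beta> where "\<beta> c = fst (h c)" for c
  have h: "h c = (\<beta> c, 1)" if "c \<in> T1" for c using that by (simp add: T1_def \<beta>_def prod_eq_iff)
  obtain S0 where "S1.full S0" "S0 \<subseteq> T" "\<forall>c\<in>S0. snd (h c) = 1"
    using linear_part_trivial[OF lin x0] by blast
  then have full: "S1.full T1" using S1.full_mono[of S0 T1] by (auto simp: T1_def)
  have sub: "add_subgroup T1"
    unfolding add_subgroup_def
  proof (intro conjI ballI)
    show "0 \<in> T1" using add_subgroup_zero[OF T] h_zero[OF lin x0] by (simp add: T1_def)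
    fix c c' assume "c \<in> T1" "c' \<in> T1"
    then have c: "c \<in> T" "c' \<in> T" "snd (h c) = 1" "snd (h c') = 1" by (auto simp: T1_def)
    show "c + c' \<in> T1" using c add_subgroup_add[OF T c(1,2)] hadd[OF c(1,2)] by (simp add: T1_def gdot_def)
    have "snd (h (c + - c)) = snd (h c) * snd (h (- c))"
      using hadd[OF c(1) add_subgroup_neg[OF T c(1)]] by (simp add: gdot_def)
    then show "- c \<in> T1" using c add_subgroup_neg[OF T c(1)] h_zero[OF lin x0] by (simp add: T1_def)
  qed
  show thesis
  proof (rule that[of T1 \<beta>])
    show "T1 \<subseteq> L1" using T_L[OF lin x0] by (auto simp: T1_def)
    show "tlabel c x0 = (\<beta> c, 1)" if "c \<in> T1" for c
      using tlabel_h[OF lin x0, of c x0] h[OF that] that x0 by (simp add: T1_def)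
    show "\<beta> (c + c') = \<beta> c + \<beta> c'" if c: "c \<in> T1" "c' \<in> T1" for c c'
    proof -
      have "h (c + c') = gdot (h c) (h c')" using hadd c by (simp add: T1_def)
      then show ?thesis
        unfolding h[OF c(1)] h[OF c(2)] h[OF add_subgroup_add[OF sub c]] by (simp add: gdot_def)
    qed
    show "c = 0" if "c \<in> T1" "\<beta> c = 0" for c
      using h_inj[OF lin x0, of c] h[OF that(1)] that by (simp add: T1_def)
    show "\<exists>w\<in>S2.G. intertwines T1 \<beta> u w" if u: "u \<in> S1.G" for u
      using G1_conjugates[OF lin x0 u] intertwines_if_conjugates[of T h _ _ u] full
      unfolding T1_def \<beta>_def by blast
    show "\<exists>u\<in>S1.G. intertwines T1 \<beta> u w" if w: "w \<in> S2.G" for w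
      using G2_conjugates[OF lin x0 w] intertwines_if_conjugates[of T h _ w] full
      unfolding T1_def \<beta>_def by blast
  qed (rule sub full)+
qed

lemma extend_additive:
  fixes f :: "'a \<Rightarrow> 'b"
  assumes T: "add_subgroup T" "S1.full T"
    and f: "\<And>c c'. c \<in> T \<Longrightarrow> c' \<in> T \<Longrightarrow> f (c + c') = f c + f c'"
  obtains H where "\<And>x y. H (x + y) = H x + H y" "\<And>c. c \<in> T \<Longrightarrow> H c = f c"
proof -
  have "\<exists>y n. n > 0 \<and> of_nat n * x \<in> T \<and> of_nat n * y = f (of_nat n * x)" for x
    using S1.full_multiple[OF T(2), of x] S2.of_nat_divide by metis
  then obtain H N where HN: "\<And>x. N x > 0" "\<And>x. of_nat (N x) * x \<in> T"
    "\<And>x. of_nat (N x) * H x = f (of_nat (N x) * x)" by metis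
  note nat = additive_of_nat[OF T(1) f]
  \<comment> \<open>\<open>H x\<close> was defined through one chosen multiplier; every multiplier
    that moves \<open>x\<close> into \<open>T\<close> gives the same value, so two points can share
    one.\<close>
  have key: "of_nat m * H x = f (of_nat m * x)" if m: "of_nat m * x \<in> T" for m x
  proof (rule S2.of_nat_cancel[OF HN(1)[of x]])
    have "of_nat (N x) * (of_nat m * H x) = of_nat m * (of_nat (N x) * H x)"
      by (simp only: mult_of_nat_of_nat[symmetric] mult.commute[of m])
    also have "\<dots> = f (of_nat m * (of_nat (N x) * x))"
      using HN(2,3) nat by simp
    also have "of_nat m * (of_nat (N x) * x) = of_nat (N x) * (of_nat m * x)"
      by (simp only: mult_of_nat_of_nat[symmetric] mult.commute[of m])
    also have "f \<dots> = of_nat (N x) * f (of_nat m * x)" by (rule nat[OF _ _ m]) 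
    finally show "of_nat (N x) * (of_nat m * H x) = of_nat (N x) * f (of_nat m * x)" .
  qed
  show thesis
  proof (rule that)
    show "H c = f c" if "c \<in> T" for c using key[of 1 c] that by simp
    fix x y
    define n where "n = N x * N y"
    have n: "n > 0" using HN(1) by (simp add: n_def)
    have nx: "of_nat n * x \<in> T" "of_nat n * y \<in> T"
      unfolding n_def mult_of_nat_of_nat'[of "N x" "N y" x] mult_of_nat_of_nat[of "N x" "N y" y]
      using add_subgroup_of_nat[OF T(1)] HN(2) by blast+
    then have nxy: "of_nat n * (x + y) \<in> T" using add_subgroup_add[OF T(1)] by (simp add: distrib_left)
    have "of_nat n * H (x + y) = f (of_nat n * x + of_nat n * y)"
      using key[OF nxy] by (simp add: distrib_left)
    also have "\<dots> = of_nat n * (H x + H y)"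
      using f[OF nx] key[OF nx(1)] key[OF nx(2)] by (simp add: distrib_left)
    finally show "H (x + y) = H x + H y" by (rule S2.of_nat_cancel[OF n])
  qed
qed

text \<open>Makes the whole linearisation available in the opposite direction, which is how
  surjectivity is obtained.\<close>

lemma inverse_iso:
  obtains \<Psi> where "groupoid_iso R2 L2 M2 R1 L1 M1 \<Psi>"
    "\<And>\<alpha>. \<alpha> \<in> S1.arrows \<Longrightarrow> \<Psi> (\<Phi> \<alpha>) = \<alpha>" "\<And>\<beta>. \<beta> \<in> S2.arrows \<Longrightarrow> \<Phi> (\<Psi> \<beta>) = \<beta>"
proof -
  obtain \<Psi> where hm: "homeomorphic_maps (gpd_top M1 L1) (gpd_top M2 L2) \<Phi> \<Psi>"
    using homeo homeomorphic_map_maps by blast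
  have inv: "\<Psi> (\<Phi> \<alpha>) = \<alpha>" if "\<alpha> \<in> S1.arrows" for \<alpha>
    using hm that S1.topspace_gpd_top by (simp add: homeomorphic_maps_def)
  have inv': "\<Phi> (\<Psi> \<beta>) = \<beta>" if "\<beta> \<in> S2.arrows" for \<beta>
    using hm that S2.topspace_gpd_top by (simp add: homeomorphic_maps_def)
  have homeo': "homeomorphic_map (gpd_top M2 L2) (gpd_top M1 L1) \<Psi>"
    using hm homeomorphic_maps_sym homeomorphic_map_maps by blast
  have A: "\<Psi> \<beta> \<in> S1.arrows" if "\<beta> \<in> S2.arrows" for \<beta>
  proof -
    have "\<beta> \<in> \<Phi> ` S1.arrows" using that \<Phi>_image by simp
    then show ?thesis using inv by (elim imageE) simp
  qed
  have "groupoid_iso R2 L2 M2 R1 L1 M1 \<Psi>"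
  proof unfold_locales
    fix \<alpha> \<beta> assume a: "\<alpha> \<in> S2.arrows" and b: "\<beta> \<in> S2.arrows"
    show iff: "gsrc \<alpha> = grng \<beta> \<longleftrightarrow> gsrc (\<Psi> \<alpha>) = grng (\<Psi> \<beta>)"
      using composable_iff[OF A[OF a] A[OF b]] inv'[OF a] inv'[OF b] by simp
    assume "gsrc \<alpha> = grng \<beta>"
    then have c: "gsrc (\<Psi> \<alpha>) = grng (\<Psi> \<beta>)" using iff by simp
    \<comment> \<open>\<Psi> undoes \<Phi> only on arrows, so the product must first be known to be
      one.\<close>
    have "gmult (\<Psi> \<alpha>) (\<Psi> \<beta>) \<in> S1.arrows"
      using A[OF a] A[OF b] c S1.arrow_comp
      by (cases "\<Psi> \<alpha>", cases "\<Psi> \<beta>") (auto simp: gmult_eq gsrc_def grng_def)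
    then have "\<Psi> (\<Phi> (gmult (\<Psi> \<alpha>) (\<Psi> \<beta>))) = gmult (\<Psi> \<alpha>) (\<Psi> \<beta>)" by (rule inv)
    then show "\<Psi> (gmult \<alpha> \<beta>) = gmult (\<Psi> \<alpha>) (\<Psi> \<beta>)"
      using comp[OF A[OF a] A[OF b] c] inv'[OF a] inv'[OF b] by simp
  qed (rule homeo')
  then show thesis using that inv inv' by blast
qed

lemma linear_model:
  obtains H :: "'a \<Rightarrow> 'b" where "\<And>x y. H (x + y) = H x + H y" "bij H"
    "\<And>u. u \<in> S1.G \<Longrightarrow> \<exists>w\<in>S2.G. \<forall>x. w * H x = H (u * x)"
    "\<And>w. w \<in> S2.G \<Longrightarrow> \<exists>u\<in>S1.G. \<forall>x. w * H x = H (u * x)"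
proof -
  define x0 where "x0 = lemb M1 L1 0"
  have x0: "x0 \<in> S1.X" unfolding x0_def using S1.lemb_X add_subgroup_zero[OF S1.L_subgroup] by blast
  obtain T \<beta> where T: "add_subgroup T" "S1.full T" "T \<subseteq> L1"
    and lab: "\<And>c. c \<in> T \<Longrightarrow> tlabel c x0 = (\<beta> c, 1)"
    and add: "\<And>c c'. c \<in> T \<Longrightarrow> c' \<in> T \<Longrightarrow> \<beta> (c + c') = \<beta> c + \<beta> c'"
    and inj: "\<And>c. c \<in> T \<Longrightarrow> \<beta> c = 0 \<Longrightarrow> c = 0"
    and G1: "\<And>u. u \<in> S1.G \<Longrightarrow> \<exists>w\<in>S2.G. intertwines T \<beta> u w"
    and G2: "\<And>w. w \<in> S2.G \<Longrightarrow> \<exists>u\<in>S1.G. intertwines T \<beta> u w"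
    using additive_linearization[OF x0] by blast
  obtain H where Hadd: "\<And>x y. H (x + y) = H x + H y" and HT: "\<And>c. c \<in> T \<Longrightarrow> H c = \<beta> c"
    using extend_additive[OF T(1,2) add] by blast
  have sgU: "add_subgroup (UNIV :: 'a set)" by (simp add: add_subgroup_def)
  have Hnat: "H (of_nat n * x) = of_nat n * H x" for n x
    using additive_of_nat[OF sgU, of H] Hadd by simp
  have inter: "w * H x = H (u * x)" if uw: "intertwines T \<beta> u w" for u w x
  proof -
    obtain T' where T': "S1.full T'" "T' \<subseteq> T" "\<forall>c\<in>T'. u * c \<in> T \<and> w * \<beta> c = \<beta> (u * c)"
      using uw unfolding intertwines_def by blast
    obtain n where n: "n > 0" "of_nat n * x \<in> T'" using S1.full_multiple[OF T'(1)] by blast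
    have "w * H (of_nat n * x) = H (u * (of_nat n * x))" using T' n(2) HT by auto
    then have "of_nat n * (w * H x) = of_nat n * H (u * x)"
      by (simp only: mult_of_nat_left_commute[of u] mult_of_nat_left_commute[of w] Hnat)
    then show ?thesis by (rule S2.of_nat_cancel[OF n(1)])
  qed
  have "inj H"
  proof (rule injI)
    fix x y assume "H x = H y"
    then have "H (x - y) = 0" using Hadd[of "x - y" y] by simp
    obtain n where n: "n > 0" "of_nat n * (x - y) \<in> T" using S1.full_multiple[OF T(2)] by blast
    have "\<beta> (of_nat n * (x - y)) = 0" using HT[OF n(2)] Hnat \<open>H (x - y) = 0\<close> by simp
    then have "of_nat n * (x - y) = of_nat n * 0" using inj[OF n(2)] by simp
    then have "x - y = 0" by (rule S1.of_nat_cancel[OF n(1)])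
    then show "x = y" by simp
  qed
  moreover have "surj H"
  proof -
    \<comment> \<open>The inverse isomorphism is linearised at the image of \<open>x0\<close>, so
      that both linearisations describe the same arrows.\<close>
    obtain \<Psi> where iso: "groupoid_iso R2 L2 M2 R1 L1 M1 \<Psi>"
      and inv: "\<And>\<alpha>. \<alpha> \<in> S1.arrows \<Longrightarrow> \<Psi> (\<Phi> \<alpha>) = \<alpha>" and inv': "\<And>\<beta>. \<beta> \<in> S2.arrows \<Longrightarrow> \<Phi> (\<Psi> \<beta>) = \<beta>"
      using inverse_iso by blast
    interpret I: groupoid_iso R2 L2 M2 R1 L1 M1 \<Psi> by (rule iso)
    define y0 where "y0 = \<phi> x0"
    have y0: "y0 \<in> S2.X" unfolding y0_def by (rule \<phi>_X[OF x0])
    obtain T2 \<beta>2 where T2: "add_subgroup T2" "S2.full T2" "T2 \<subseteq> L2"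
      and lab2: "\<And>c. c \<in> T2 \<Longrightarrow> I.tlabel c y0 = (\<beta>2 c, 1)"
      and add2: "\<And>c c'. c \<in> T2 \<Longrightarrow> c' \<in> T2 \<Longrightarrow> \<beta>2 (c + c') = \<beta>2 c + \<beta>2 c'"
      by (rule I.additive_linearization[OF y0]) (rule that; (assumption | blast))
    have base: "I.\<phi> y0 = x0"
    proof -
      have "\<Psi> (y0, (0, 1), y0) = (x0, (0, 1), x0)"
        using inv[OF S1.unit_arrow[OF x0]] \<Phi>_eq[OF S1.unit_arrow[OF x0]] label_unit[OF x0]
        by (simp add: y0_def)
      then show ?thesis by (simp add: I.\<phi>_def gsrc_def)
    qed
    \<comment> \<open>\<Psi> sends the translation of \<open>y0\<close> by \<open>d\<close> to the
      translation of \<open>x0\<close> by \<open>\<beta>2 d\<close>; applying \<Phi> again returns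
      the label \<open>(d, 1)\<close>.\<close>
    have \<beta>\<beta>2: "\<beta> (\<beta>2 d) = d" if d: "d \<in> T2" "\<beta>2 d \<in> T" for d
    proof -
      have a: "(translate d y0, (d, 1), y0) \<in> S2.arrows"
        using S2.translate_arrow[OF y0] d(1) T2(3) by blast
      have \<Psi>: "\<Psi> (translate d y0, (d, 1), y0) = (I.\<phi> (translate d y0), (\<beta>2 d, 1), x0)"
        using I.\<Phi>_eq[OF a] lab2[OF d(1)] base by (simp add: I.tlabel_def)
      have "(I.\<phi> (translate d y0), (\<beta>2 d, 1), x0) \<in> S1.arrows" using I.\<Phi>_arrow[OF a] \<Psi> by simp
      then have "I.\<phi> (translate d y0) = translate (\<beta>2 d) x0" by (rule S1.translation_arrow_range)
      then have "label (translate (\<beta>2 d) x0, (\<beta>2 d, 1), x0) = (d, 1)"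
        using inv'[OF a] \<Psi> by (simp add: label_def)
      then show ?thesis using lab[OF d(2)] by (simp add: tlabel_def)
    qed
    have "y \<in> range H" for y
    proof -
      obtain n where n: "n > 0" "of_nat n * y \<in> T2" using S2.full_multiple[OF T2(2)] by blast
      define d where "d = of_nat n * y"
      \<comment> \<open>\<open>\<beta>2 d\<close> may miss \<open>T\<close>; a multiple of it does
        not, and additivity on both sides lets \<open>m\<close> cancel.\<close>
      obtain m where m: "m > 0" "of_nat m * \<beta>2 d \<in> T" using S1.full_multiple[OF T(2)] by blast
      have d: "d \<in> T2" using n(2) by (simp add: d_def)
      have b: "\<beta>2 (of_nat m * d) = of_nat m * \<beta>2 d" by (rule additive_of_nat[OF T2(1) add2 d])
      have "H (of_nat m * \<beta>2 d) = of_nat m * d"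
        using HT[OF m(2)] \<beta>\<beta>2[of "of_nat m * d"] b m(2) add_subgroup_of_nat[OF T2(1) d] by simp
      then have e: "of_nat m * H (\<beta>2 d) = of_nat m * d" by (simp only: Hnat)
      have "H (\<beta>2 d) = d" using S2.of_nat_cancel[OF m(1) e] .
      moreover obtain z where "of_nat n * z = \<beta>2 d" using S1.of_nat_divide[OF n(1)] by blast
      ultimately have "of_nat n * H z = of_nat n * y" using Hnat[of n z] by (simp add: d_def)
      then show ?thesis using S2.of_nat_cancel[OF n(1)] by blast
    qed
    then show ?thesis by blast
  qed
  ultimately have "bij H" by (simp add: bij_def)
  moreover have "\<exists>w\<in>S2.G. \<forall>x. w * H x = H (u * x)" if "u \<in> S1.G" for u
    using G1[OF that] inter by blast
  moreover have "\<exists>u\<in>S1.G. \<forall>x. w * H x = H (u * x)" if "w \<in> S2.G" for w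
    using G2[OF that] inter by blast
  ultimately show thesis using that Hadd by blast
qed

text \<open>Left multiplication represents each algebra faithfully on itself. \<open>H\<close>
  carries left multiplications by group elements to such, in both directions; sums, negatives and
  division by integers extend this to all of QR.\<close>

lemma algebra_iso:
  obtains \<theta> :: "'a \<Rightarrow> 'b" where "qalg_iso \<theta>" "\<theta> ` S1.G \<subseteq> S2.G" "S2.G \<subseteq> \<theta> ` S1.G"
proof -
  obtain H :: "'a \<Rightarrow> 'b" where Hadd: "\<And>x y. H (x + y) = H x + H y" and bij: "bij H"
    and G1: "\<And>u. u \<in> S1.G \<Longrightarrow> \<exists>w\<in>S2.G. \<forall>x. w * H x = H (u * x)"
    and G2: "\<And>w. w \<in> S2.G \<Longrightarrow> \<exists>u\<in>S1.G. \<forall>x. w * H x = H (u * x)"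
    using linear_model by blast
  have H0: "H 0 = 0" using Hadd[of 0 0] by simp
  have Hneg: "H (- x) = - H x" for x using Hadd[of x "- x"] H0 by (simp add: eq_neg_iff_add_eq_0 add.commute)
  have sgU: "add_subgroup (UNIV :: 'a set)" by (simp add: add_subgroup_def)
  have Hnat: "H (of_nat n * x) = of_nat n * H x" for n x
    using additive_of_nat[OF sgU, of H] Hadd by simp
  \<comment> \<open>\<open>H\<close> need not send 1 to 1. Evaluating an operator
    \<open>s * _\<close> at \<open>H e = 1\<close> recovers \<open>s\<close>, which gives the
    formula for \<theta> below.\<close>
  obtain e where e: "H e = 1" using bij by (metis bij_pointE)
  have ex1: "\<exists>s. \<forall>x. s * H x = H (r * x)" for r
  proof (induction r rule: S1.Q_span_G_induct)
    case (1 u)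
    then show ?case using G1 by blast
  next
    case 2
    then show ?case by (intro exI[of _ 0]) (simp add: H0)
  next
    case (3 r r')
    then obtain s s' where "\<forall>x. s * H x = H (r * x)" "\<forall>x. s' * H x = H (r' * x)" by blast
    then show ?case by (intro exI[of _ "s + s'"]) (simp add: distrib_right Hadd)
  next
    case (4 r)
    then obtain s where "\<forall>x. s * H x = H (r * x)" by blast
    then show ?case by (intro exI[of _ "- s"]) (simp add: Hneg)
  next
    case (5 n r)
    then obtain s where s: "\<forall>x. s * H x = H (of_nat n * r * x)" by blast
    obtain t where t: "of_nat n * t = s" using S2.of_nat_divide[OF 5(1)] by blast
    have "t * H x = H (r * x)" for x
    proof (rule S2.of_nat_cancel[OF 5(1)])
      have "of_nat n * (t * H x) = s * H x" unfolding t[symmetric] by (simp only: mult.assoc)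
      then show "of_nat n * (t * H x) = of_nat n * H (r * x)" using s by (simp add: mult.assoc Hnat)
    qed
    then show ?case by blast
  qed
  have ex2: "\<exists>r. \<forall>x. s * H x = H (r * x)" for s
  proof (induction s rule: S2.Q_span_G_induct)
    case (1 u)
    then show ?case using G2 by blast
  next
    case 2
    then show ?case by (intro exI[of _ 0]) (simp add: H0)
  next
    case (3 s s')
    then obtain r r' where "\<forall>x. s * H x = H (r * x)" "\<forall>x. s' * H x = H (r' * x)" by blast
    then show ?case by (intro exI[of _ "r + r'"]) (simp add: distrib_right Hadd)
  next
    case (4 s)
    then obtain r where "\<forall>x. s * H x = H (r * x)" by blast
    then show ?case by (intro exI[of _ "- r"]) (simp add: Hneg)
  next
    case (5 n s)
    then obtain r where r: "\<forall>x. of_nat n * s * H x = H (r * x)" by blast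
    obtain t where t: "of_nat n * t = r" using S1.of_nat_divide[OF 5(1)] by blast
    have "s * H x = H (t * x)" for x
    proof (rule S2.of_nat_cancel[OF 5(1)])
      show "of_nat n * (s * H x) = of_nat n * H (t * x)"
        using r unfolding t[symmetric] by (simp add: mult.assoc Hnat)
    qed
    then show ?case by blast
  qed
  define \<theta> where "\<theta> r = H (r * e)" for r
  have eq\<theta>: "\<theta> r = s" if "\<forall>x. s * H x = H (r * x)" for r s
    using that e unfolding \<theta>_def by (metis mult.right_neutral)
  have \<theta>: "\<theta> r * H x = H (r * x)" for r x using ex1[of r] eq\<theta> by metis
  have "inj \<theta>"
  proof (rule injI)
    fix r r' assume "\<theta> r = \<theta> r'"
    then have "H (r * 1) = H (r' * 1)" using \<theta> by metis
    then show "r = r'" using bij by (simp add: bij_def inj_eq)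
  qed
  moreover have "surj \<theta>" using ex2 eq\<theta> by (metis surjI)
  moreover have "\<theta> (r * r') = \<theta> r * \<theta> r'" for r r'
    using \<theta>[of r "r' * e"] by (simp add: \<theta>_def mult.assoc)
  moreover have "\<theta> (r + r') = \<theta> r + \<theta> r'" for r r' by (simp add: \<theta>_def distrib_right Hadd)
  moreover have "\<theta> 1 = 1" by (simp add: \<theta>_def e)
  ultimately have "qalg_iso \<theta>" by (simp add: qalg_iso_def bij_def)
  moreover have "\<theta> ` S1.G \<subseteq> S2.G" using G1 eq\<theta> by blast
  moreover have "S2.G \<subseteq> \<theta> ` S1.G" using G2 eq\<theta> by blast
  ultimately show thesis by (rule that)
qed

end

section \<open>Passing to the inverse isomorphism\<close>

lemma qalg_iso_inv:
  assumes "qalg_iso \<theta>"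
  shows "qalg_iso (inv \<theta>)"
proof -
  have b: "bij \<theta>" and h: "\<And>x y. \<theta> (x + y) = \<theta> x + \<theta> y" "\<And>x y. \<theta> (x * y) = \<theta> x * \<theta> y" "\<theta> 1 = 1"
    using assms by (auto simp: qalg_iso_def)
  have s: "\<theta> (inv \<theta> y) = y" for y using b by (simp add: bij_is_surj surj_f_inv_f)
  have i: "inv \<theta> (\<theta> x) = x" for x using b by (simp add: bij_is_inj)
  have "inv \<theta> (x + y) = inv \<theta> x + inv \<theta> y" "inv \<theta> (x * y) = inv \<theta> x * inv \<theta> y" for x y
    using i[of "inv \<theta> x + inv \<theta> y"] i[of "inv \<theta> x * inv \<theta> y"] by (simp_all add: h s)
  moreover have "inv \<theta> 1 = 1" using i[of 1] by (simp add: h)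
  ultimately show ?thesis using bij_imp_bij_inv[OF b] by (simp add: qalg_iso_def)
qed

theorem theorem5p19:
  fixes R1 L1 M1 :: "'a::ring_1 set" and R2 L2 M2 :: "'b::ring_1 set"
  assumes "subring1 R1" "fg_add R1" "is_QR R1"
    and "add_subgroup L1" "L1 \<subseteq> R1" "zrank L1 = zrank R1"
    and "submonoid M1" "M1 \<subseteq> left_regular R1" "\<forall>a\<in>M1. \<forall>x\<in>L1. a * x \<in> L1"
    and "finite_index (zspan M1) R1"
    and "\<exists>\<kappa>::int. \<kappa> \<noteq> 0 \<and> \<kappa> \<noteq> 1 \<and> of_int \<kappa> \<in> M1"
    and "(jacobson_radical :: 'a set) = {0}"
  assumes "subring1 R2" "fg_add R2" "is_QR R2"
    and "add_subgroup L2" "L2 \<subseteq> R2" "zrank L2 = zrank R2"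
    and "submonoid M2" "M2 \<subseteq> left_regular R2" "\<forall>a\<in>M2. \<forall>x\<in>L2. a * x \<in> L2"
    and "finite_index (zspan M2) R2"
    and "\<exists>\<kappa>::int. \<kappa> \<noteq> 0 \<and> \<kappa> \<noteq> 1 \<and> of_int \<kappa> \<in> M2"
    and "(jacobson_radical :: 'b set) = {0}"
  assumes "gpd_isomorphic M1 L1 M2 L2"
  shows "\<exists>(\<phi>1 :: 'a \<Rightarrow> 'b) (\<phi>2 :: 'b \<Rightarrow> 'a). qalg_iso \<phi>1 \<and> qalg_iso \<phi>2 \<and>
           \<phi>1 ` gen_group M1 \<subseteq> gen_group M2 \<and> \<phi>2 ` gen_group M2 \<subseteq> gen_group M1"
proof -
  obtain \<Phi> where \<Phi>: "homeomorphic_map (gpd_top M1 L1) (gpd_top M2 L2) \<Phi>"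
    "\<forall>\<alpha>\<in>gpd_arrows M1 L1. \<forall>\<beta>\<in>gpd_arrows M1 L1.
        (gsrc \<alpha> = grng \<beta> \<longleftrightarrow> gsrc (\<Phi> \<alpha>) = grng (\<Phi> \<beta>)) \<and>
        (gsrc \<alpha> = grng \<beta> \<longrightarrow> \<Phi> (gmult \<alpha> \<beta>) = gmult (\<Phi> \<alpha>) (\<Phi> \<beta>))"
    using assms(25) unfolding gpd_isomorphic_def by blast
  have 1: "algebraic_system R1 L1 M1" by unfold_locales (fact assms)+
  have 2: "algebraic_system R2 L2 M2" by unfold_locales (fact assms)+
  interpret groupoid_iso R1 L1 M1 R2 L2 M2 \<Phi>
    by (intro groupoid_iso.intro groupoid_iso_axioms.intro 1 2 \<Phi>(1)) (use \<Phi>(2) in blast)+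
  obtain \<theta> :: "'a \<Rightarrow> 'b" where \<theta>: "qalg_iso \<theta>" "\<theta> ` gen_group M1 \<subseteq> gen_group M2"
    "gen_group M2 \<subseteq> \<theta> ` gen_group M1"
    using algebra_iso .
  \<comment> \<open>This inclusion rests on \<theta> reaching every element of the second group
    already from the first group.\<close>
  have "inv \<theta> ` gen_group M2 \<subseteq> inv \<theta> ` \<theta> ` gen_group M1" using \<theta>(3) by (rule image_mono)
  also have "\<dots> = gen_group M1"
    using \<theta>(1) by (simp add: qalg_iso_def bij_is_inj image_inv_f_f)
  finally show ?thesis using \<theta>(1,2) qalg_iso_inv[OF \<theta>(1)] by blast
qed

end
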